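(* Let $(G,\Gamma)$ be a $d$-periodic graph with $n=|V/\Gamma|$, and consider the left action of $Aut(G,\Gamma)$ on periodic placements in $\mathbb{R}^d$ given by $$\sigma(p,\pi)=(p\circ\sigma^{-1},\ \pi\circ C_{\sigma^{-1}}),\qquad \sigma\in Aut(G,\Gamma).$$ (1) When expressed in the parameters $(t_1,\dots,t_{n-1},\omega)\in(\mathbb{R}^d)^{n-1}\times\Omega(d)\subset\mathbb{R}^{dn+\binom{d}{2}}$, this action corresponds with an affine representation $$A: Aut(G,\Gamma)\to Aff\left(dn+\tbinom{d}{2}\right),$$ that is, a group homomorphism $A$ into the group of invertible affine transformations of $\mathbb{R}^{dn+\binom{d}{2}}$ such that each $A(\sigma)$ maps the parameter point of $(p,\pi)$ to the parameter point of $\sigma(p,\pi)$. The representation $A$ factors through $Aut(G,\Gamma)/\Gamma=Aut(G/\Gamma)$. (2) For any subgroup $\Sigma$ with $\Gamma\subset\Sigma\subset Aut(G,\Gamma)$, the periodic placements of $(G,\Gamma)$ with crystallographic symmetry $\Sigma$ (up to Euclidean isometry) are parametrized by the fixed locus of $A(\Sigma)$ in $(\mathbb{R}^d)^{n-1}\times\Omega(d)$, that is, by $$\mathcal{F}(\Sigma)=\{x\in(\mathbb{R}^d)^{n-1}\times\Omega(d)\ :\ A(\sigma)x=x\ \text{ for all }\sigma\in\Sigma\}.$$ (3) The locus with full symmetry $\mathcal{F}(Aut(G,\Gamma))$ is not empty.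
   Context: A $d$-periodic graph $(G,\Gamma)$ consists of an infinite connected graph $G=(V,E)$ and a free Abelian group $\Gamma\subset Aut(G)$ of rank $d$, acting freely on $V$, such that the quotient multigraph $G/\Gamma$ is finite. $Aut(G,\Gamma)$ denotes the normalizer of $\Gamma$ in $Aut(G)$. The quotient group $Aut(G,\Gamma)/\Gamma$ acts naturally on the quotient multigraph $G/\Gamma$, and $Aut(G/\Gamma)$ denotes the automorphism group of $G/\Gamma$. For $\sigma\in Aut(G,\Gamma)$, $C_\sigma$ is the automorphism $\gamma\mapsto\sigma\gamma\sigma^{-1}$ of $\Gamma$. A periodic placement $(p,\pi)$ of $(G,\Gamma)$ in $\mathbb{R}^d$ consists of a function $p:V\to\mathbb{R}^d$ and an injective homomorphism $\pi:\Gamma\to\mathcal{T}(\mathbb{R}^d)$ into the group of translations of $\mathbb{R}^d$ (identified with $\mathbb{R}^d$), whose image is a lattice of rank $d$, such that $p\circ\gamma=\pi(\gamma)\circ p$ for all $\gamma\in\Gamma$. The resulting periodic framework is denoted $(G,\Gamma,p,\pi)$. Parameters: fix representatives $v_0,\dots,v_{n-1}$ of the $\Gamma$-orbits on $V$ and an isomorphism $\mathbb{Z}^d\approx\Gamma$, with $e_1,\dots,e_d$ the standard basis of $\mathbb{Z}^d$. For a placement $(p,\pi)$ let $\Lambda\in GL(d,\mathbb{R})$ be the matrix with columns $\pi(e_1),\dots,\pi(e_d)$; its parameter point is $(t_1,\dots,t_{n-1},\omega)$ with $t_i=\Lambda^{-1}(p(v_i)-p(v_0))$ and $\omega=\Lambda^t\Lambda\in\Omega(d)$,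 where $\Omega(d)$ is the open cone of positive definite real symmetric $d\times d$ matrices. Two placements have the same parameter point exactly when they are equivalent under the isometry group $E(d)$, acting by $u\cdot(p,\pi)=(u\circ p,U\pi)$ for $u(x)=Ux+t$, and every point of $(\mathbb{R}^d)^{n-1}\times\Omega(d)$ (an open subset of $\mathbb{R}^{dn+\binom{d}{2}}$) is the parameter point of some placement. An element $\sigma\in Aut(G,\Gamma)$ is a symmetry of the framework $(G,\Gamma,p,\pi)$ if there is an isometry $s\in E(d)$ with $s\circ p=p\circ\sigma$. A placement is said here to have crystallographic symmetry $\Sigma$ when every $\sigma\in\Sigma$ is a symmetry of $(G,\Gamma,p,\pi)$.
   Formalization: Aut(G,Γ)/Γ = Aut(G/Γ) fails in general (not every automorphism of G/Γ lifts); instead Aut(G,Γ)/Γ is shown isomorphic to its image, a subgroup of Aut(G/Γ) (automorphisms acting on oriented edges), and A factors through both. *)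

theory Defs
  imports
    "HOL-Analysis.Analysis"
    "HOL-Algebra.Coset"
    "HOL-Algebra.Bij"
    "HOL-Algebra.Group_Action"
    "HOL-Algebra.Free_Abelian_Groups"
begin

section \<open>Periodic graphs\<close>

text \<open>The vertex set of a graph is the whole type \<open>'v\<close>; edges are two-element sets of vertices.\<close>

definition simple_graph :: "'v set set \<Rightarrow> bool" where
  "simple_graph E \<longleftrightarrow> (\<forall>e\<in>E. card e = 2)"

definition connected_graph :: "'v set set \<Rightarrow> bool" where
  "connected_graph E \<longleftrightarrow> (\<forall>x y. (x, y) \<in> {(u, w). {u, w} \<in> E}\<^sup>*)"

definition graph_Aut :: "'v set set \<Rightarrow> ('v \<Rightarrow> 'v) monoid" where
  "graph_Aut E = (BijGroup UNIV)
     \<lparr>carrier := {f \<in> Bij UNIV. \<forall>u w. {u, w} \<in> E \<longleftrightarrow> {f u, f w} \<in> E}\<rparr>"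

text \<open>A multigraph is given by its vertices and its darts (oriented edges), with origin map and
  edge reversal; an edge is a pair of mutually reverse darts.  Automorphisms act on darts, so that
  reversing a loop is a nontrivial automorphism.\<close>

record ('a, 'b) multigraph =
  mverts :: "'a set"
  mdarts :: "'b set"
  morigin :: "'b \<Rightarrow> 'a"
  mrev :: "'b \<Rightarrow> 'b"

definition finite_multigraph :: "('a, 'b) multigraph \<Rightarrow> bool" where
  "finite_multigraph Q \<longleftrightarrow> finite (mverts Q) \<and> finite (mdarts Q)"

definition multigraph_Aut ::
    "('a, 'b) multigraph \<Rightarrow> (('a \<Rightarrow> 'a) \<times> ('b \<Rightarrow> 'b)) monoid" where
  "multigraph_Aut Q = (BijGroup (mverts Q) \<times>\<times> BijGroup (mdarts Q))
     \<lparr>carrier := {(f, g). f \<in> Bij (mverts Q) \<and> g \<in> Bij (mdarts Q) \<and>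
        (\<forall>a\<in>mdarts Q. morigin Q (g a) = f (morigin Q a) \<and> mrev Q (g a) = g (mrev Q a))}\<rparr>"

abbreviation subgroup_of_Aut :: "'v set set \<Rightarrow> ('v \<Rightarrow> 'v) set \<Rightarrow> ('v \<Rightarrow> 'v) monoid" where
  "subgroup_of_Aut E \<Gamma> \<equiv> (graph_Aut E)\<lparr>carrier := \<Gamma>\<rparr>"

definition vertex_orbit :: "'v set set \<Rightarrow> ('v \<Rightarrow> 'v) set \<Rightarrow> 'v \<Rightarrow> 'v set" where
  "vertex_orbit E \<Gamma> x = orbit (subgroup_of_Aut E \<Gamma>) (\<lambda>\<gamma>. \<gamma>) x"

definition vertex_orbits :: "'v set set \<Rightarrow> ('v \<Rightarrow> 'v) set \<Rightarrow> 'v set set" where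
  "vertex_orbits E \<Gamma> = orbits (subgroup_of_Aut E \<Gamma>) UNIV (\<lambda>\<gamma>. \<gamma>)"

definition dart_orbits :: "'v set set \<Rightarrow> ('v \<Rightarrow> 'v) set \<Rightarrow> ('v \<times> 'v) set set" where
  "dart_orbits E \<Gamma> =
     orbits (subgroup_of_Aut E \<Gamma>) {(u, w). {u, w} \<in> E} (\<lambda>\<gamma>. map_prod \<gamma> \<gamma>)"

definition quotient_multigraph ::
    "'v set set \<Rightarrow> ('v \<Rightarrow> 'v) set \<Rightarrow> ('v set, ('v \<times> 'v) set) multigraph" where
  "quotient_multigraph E \<Gamma> =
     \<lparr>mverts = vertex_orbits E \<Gamma>, mdarts = dart_orbits E \<Gamma>,
      morigin = (\<lambda>a. fst ` a), mrev = (\<lambda>a. prod.swap ` a)\<rparr>"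

definition periodic_graph :: "nat \<Rightarrow> 'v set set \<Rightarrow> ('v \<Rightarrow> 'v) set \<Rightarrow> bool" where
  "periodic_graph d E \<Gamma> \<longleftrightarrow>
     infinite (UNIV :: 'v set) \<and> simple_graph E \<and> connected_graph E \<and>
     subgroup \<Gamma> (graph_Aut E) \<and>
     free_Abelian_group {..<d} \<cong> subgroup_of_Aut E \<Gamma> \<and>
     (\<forall>\<gamma>\<in>\<Gamma>. \<forall>x. \<gamma> x = x \<longrightarrow> \<gamma> = id) \<and>
     finite_multigraph (quotient_multigraph E \<Gamma>)"

definition periodic_Aut :: "'v set set \<Rightarrow> ('v \<Rightarrow> 'v) set \<Rightarrow> ('v \<Rightarrow> 'v) monoid" where
  "periodic_Aut E \<Gamma> = (graph_Aut E)\<lparr>carrier := normalizer (graph_Aut E) \<Gamma>\<rparr>"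

text \<open>The automorphism of the quotient multigraph induced by an automorphism of the graph
  that normalizes \<open>\<Gamma>\<close>.\<close>

definition quotient_action ::
    "'v set set \<Rightarrow> ('v \<Rightarrow> 'v) set \<Rightarrow> ('v \<Rightarrow> 'v) \<Rightarrow>
     ('v set \<Rightarrow> 'v set) \<times> (('v \<times> 'v) set \<Rightarrow> ('v \<times> 'v) set)" where
  "quotient_action E \<Gamma> \<sigma> =
     ((\<lambda>a\<in>vertex_orbits E \<Gamma>. \<sigma> ` a), (\<lambda>a\<in>dart_orbits E \<Gamma>. map_prod \<sigma> \<sigma> ` a))"

definition conj_aut :: "('v \<Rightarrow> 'v) set \<Rightarrow> ('v \<Rightarrow> 'v) \<Rightarrow> ('v \<Rightarrow> 'v) \<Rightarrow> ('v \<Rightarrow> 'v)" where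
  "conj_aut \<Gamma> \<sigma> = (\<lambda>\<gamma>\<in>\<Gamma>. \<sigma> \<circ> \<gamma> \<circ> inv_into UNIV \<sigma>)"


section \<open>Periodic placements\<close>

definition full_lattice :: "(real^'d) set \<Rightarrow> bool" where
  "full_lattice L \<longleftrightarrow>
     (\<exists>B. independent B \<and> span B = UNIV \<and>
          L = {\<Sum>b\<in>B. of_int (k b) *\<^sub>R b | k :: real^'d \<Rightarrow> int. True})"

type_synonym ('v, 'd) placement =
  "('v \<Rightarrow> (real, 'd) vec) \<times> (('v \<Rightarrow> 'v) \<Rightarrow> (real, 'd) vec)"

text \<open>A translation is identified with its translation vector.\<close>

definition placements ::
    "('v \<Rightarrow> 'v) set \<Rightarrow> ('v, 'd::finite) placement set" where
  "placements \<Gamma> = {(p, \<pi>).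
     \<pi> \<in> extensional \<Gamma> \<and>
     (\<forall>\<gamma>\<in>\<Gamma>. \<forall>\<delta>\<in>\<Gamma>. \<pi> (\<gamma> \<circ> \<delta>) = \<pi> \<gamma> + \<pi> \<delta>) \<and>
     inj_on \<pi> \<Gamma> \<and>
     full_lattice (\<pi> ` \<Gamma>) \<and>
     (\<forall>\<gamma>\<in>\<Gamma>. \<forall>x. p (\<gamma> x) = p x + \<pi> \<gamma>)}"

definition placement_action ::
    "('v \<Rightarrow> 'v) set \<Rightarrow> ('v \<Rightarrow> 'v) \<Rightarrow>
     ('v, 'd::finite) placement \<Rightarrow> ('v, 'd) placement" where
  "placement_action \<Gamma> \<sigma> = (\<lambda>(p, \<pi>).
     (p \<circ> inv_into UNIV \<sigma>, restrict (\<pi> \<circ> conj_aut \<Gamma> (inv_into UNIV \<sigma>)) \<Gamma>))"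

definition isometry_equivalent ::
    "('v \<Rightarrow> 'v) set \<Rightarrow>
     ('v, 'd::finite) placement \<Rightarrow> ('v, 'd) placement \<Rightarrow> bool" where
  "isometry_equivalent \<Gamma> P Q \<longleftrightarrow>
     (\<exists>U t. orthogonal_transformation U \<and>
        Q = ((\<lambda>x. U x + t) \<circ> fst P, restrict (U \<circ> snd P) \<Gamma>))"

definition framework_symmetry ::
    "('v, 'd::finite) placement \<Rightarrow> ('v \<Rightarrow> 'v) \<Rightarrow> bool" where
  "framework_symmetry P \<sigma> \<longleftrightarrow>
     (\<exists>U t. orthogonal_transformation U \<and> (\<lambda>x. U x + t) \<circ> fst P = fst P \<circ> \<sigma>)"

definition symmetric_placements ::
    "('v \<Rightarrow> 'v) set \<Rightarrow> ('v \<Rightarrow> 'v) set \<Rightarrow>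
     ('v, 'd::finite) placement set" where
  "symmetric_placements \<Gamma> \<Sigma> = {P \<in> placements \<Gamma>. \<forall>\<sigma>\<in>\<Sigma>. framework_symmetry P \<sigma>}"


section \<open>Parameters\<close>

type_synonym ('d, 'n) params = "((real, 'd) vec, 'n) vec \<times> ((real, 'd) vec, 'd) vec"

text \<open>\<open>\<phi>\<close> is the chosen isomorphism of the free Abelian group on \<open>'d\<close> with \<open>\<Gamma>\<close>;
  \<open>frag_of j\<close> is its standard basis element with index \<open>j\<close>.\<close>

definition lattice_matrix ::
    "(('d::finite \<Rightarrow>\<^sub>0 int) \<Rightarrow> ('v \<Rightarrow> 'v)) \<Rightarrow> (('v \<Rightarrow> 'v) \<Rightarrow> real^'d) \<Rightarrow> real^'d^'d" where
  "lattice_matrix \<phi> \<pi> = (\<chi> i j. \<pi> (\<phi> (frag_of j)) $ i)"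

text \<open>The \<open>n\<close> orbit representatives are indexed by the finite type \<open>'n\<close> with a distinguished index
  \<open>i0\<close> in the role of \<open>0\<close>.  The component \<open>i0\<close> of the tuple of relative positions is always zero,
  and tuples with this property represent the elements of the \<open>(n - 1)\<close>-fold power of \<open>real^'d\<close>.\<close>

definition parameter_point ::
    "(('d::finite \<Rightarrow>\<^sub>0 int) \<Rightarrow> ('v \<Rightarrow> 'v)) \<Rightarrow> ('n::finite \<Rightarrow> 'v) \<Rightarrow> 'n \<Rightarrow>
     ('v, 'd) placement \<Rightarrow> ('d, 'n) params" where
  "parameter_point \<phi> v i0 = (\<lambda>(p, \<pi>). let \<Lambda> = lattice_matrix \<phi> \<pi> in
     ((\<chi> i. matrix_inv \<Lambda> *v (p (v i) - p (v i0))), transpose \<Lambda> ** \<Lambda>))"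

definition parameter_space :: "'n::finite \<Rightarrow> ('d::finite, 'n) params set" where
  "parameter_space i0 = {(t, \<omega>). t $ i0 = 0 \<and> transpose \<omega> = \<omega>}"

definition positive_definite :: "real^'d^'d \<Rightarrow> bool" where
  "positive_definite \<omega> \<longleftrightarrow> transpose \<omega> = \<omega> \<and> (\<forall>x. x \<noteq> 0 \<longrightarrow> x \<bullet> (\<omega> *v x) > 0)"

definition parameter_domain :: "'n::finite \<Rightarrow> ('d::finite, 'n) params set" where
  "parameter_domain i0 = {(t, \<omega>). t $ i0 = 0 \<and> positive_definite \<omega>}"

text \<open>The group of invertible affine transformations of a linear subspace \<open>W\<close>.\<close>

definition Aff :: "'a::real_vector set \<Rightarrow> ('a \<Rightarrow> 'a) monoid" where
  "Aff W = (BijGroup W)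
     \<lparr>carrier := {f \<in> Bij W. \<exists>L c. linear L \<and> (\<forall>x\<in>W. f x = L x + c)}\<rparr>"

definition fixed_locus ::
    "'n::finite \<Rightarrow> (('v \<Rightarrow> 'v) \<Rightarrow> ('d::finite, 'n) params \<Rightarrow> ('d, 'n) params) \<Rightarrow>
     ('v \<Rightarrow> 'v) set \<Rightarrow> ('d, 'n) params set" where
  "fixed_locus i0 A \<Sigma> = {x \<in> parameter_domain i0. \<forall>\<sigma>\<in>\<Sigma>. A \<sigma> x = x}"

end

theory Submission
  imports Defs "HOL-Algebra.Zassenhaus"
begin

text \<open>An automorphism \<open>\<sigma>\<close> normalizing \<open>\<Gamma>\<close> permutes the orbits of vertices up to lattice
  translations and acts on \<open>\<Gamma>\<close> by an integral matrix, so it changes the parameters of every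
  placement by one and the same affine map.  Every point of the parameter domain is the parameter
  point of a placement, and every point \<open>x\<close> of the parameter space is a combination
  \<open>a - b + c\<close> of points of the domain; hence an affine map is determined by its values on the
  domain, and the composition laws are inherited from the action on placements.  Two placements
  have the same parameters iff they are isometric, which turns crystallographic symmetry into
  fixed points.  Since \<open>\<Gamma>\<close> acts trivially and the quotient group embeds into the automorphism
  group of a finite multigraph, the representation has finite image, and the barycenter of an
  orbit in the convex parameter domain is fixed.\<close>

text \<open>The parameters forget the lattice matrix: \<omega> determines \<Lambda> only up to an
  orthogonal factor on the left. The action descends to parameters because an automorphism changes
  \<Lambda> by an integral matrix C on the right: the Gram matrix of \<Lambda> C is C^T \<omega> C,
  linear in \<omega>, and \<Lambda> itself cancels from the relative positions. The translation
  parts come from the lattice vectors by which chosen orbit representatives are carried away from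
  one another. The domain is an open cone, so its points reach the whole parameter space only
  through differences; the coefficients 1, -1, 1 sum to one and are therefore respected by affine
  maps. That the quotient group embeds into multigraph automorphisms depends on darts. The
  reflection of the integer line fixes the vertex and the loop of its quotient without being a
  translation; it is detected only because it exchanges the two darts. Since the group contains
  \<Gamma> it is infinite, so an orbit can be averaged only after \<Gamma> has been factored
  out.\<close>

section \<open>Gram matrices\<close>

lemma
  fixes L :: "real^'d^'d"
  assumes "invertible L"
  shows matrix_inv_right: "L ** matrix_inv L = mat 1"
    and matrix_inv_left: "matrix_inv L ** L = mat 1"
  using someI_ex[OF assms[unfolded invertible_def]] by (simp_all add: matrix_inv_def)

lemma transpose_add: "transpose (A + B) = transpose A + transpose B"
  by (simp add: transpose_def vec_eq_iff)

lemma transpose_zero [simp]: "transpose 0 = 0"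
  by (simp add: transpose_def vec_eq_iff)

lemma inner_gram: "x \<bullet> ((transpose L ** L) *v y) = (L *v x) \<bullet> (L *v (y :: real^'d))" for L :: "real^'d^'m"
  by (metis dot_lmul_matrix matrix_vector_mul_assoc transpose_matrix_vector vector_transpose_matrix)

lemma positive_definite_gram:
  fixes L :: "real^'d^'d"
  assumes "invertible L"
  shows "positive_definite (transpose L ** L)"
proof -
  have "L *v x \<noteq> 0" if "x \<noteq> 0" for x
    using assms that by (metis invertible_def matrix_left_invertible_ker)
  then show ?thesis
    by (simp add: positive_definite_def matrix_transpose_mul inner_gram)
qed

text \<open>The factor L^T L in the middle of the product cancels against the two inverses of L. The
  matrix \<open>K ** matrix_inv L\<close> carries the columns of \<open>L\<close> to those of
  \<open>K\<close>, so this yields the rotation between two placements with the same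
  \<omega>.\<close>

lemma orthogonal_matrix_of_gram_eq:
  fixes K L :: "real^'d^'d"
  assumes L: "invertible L" and eq: "transpose K ** K = transpose L ** L"
  shows "orthogonal_matrix (K ** matrix_inv L)"
proof -
  have r: "L ** matrix_inv L = mat 1"
    using L by (simp add: matrix_inv_right)
  have "transpose (K ** matrix_inv L) ** (K ** matrix_inv L)
      = transpose (matrix_inv L) ** (transpose K ** K) ** matrix_inv L"
    by (simp add: matrix_transpose_mul matrix_mul_assoc)
  also have "\<dots> = transpose (L ** matrix_inv L) ** (L ** matrix_inv L)"
    by (simp add: eq matrix_transpose_mul matrix_mul_assoc)
  finally show ?thesis
    by (simp add: orthogonal_matrix r)
qed

text \<open>Gram-Schmidt for the inner product defined by \<omega>, one vector per induction
  step.\<close>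

lemma exists_form_orthonormal:
  fixes \<omega> :: "real^'d^'d"
  assumes pd: "positive_definite \<omega>" and "n \<le> CARD('d)"
  shows "\<exists>S. finite S \<and> card S = n \<and> (\<forall>s\<in>S. \<forall>t\<in>S. s \<bullet> (\<omega> *v t) = (if s = t then 1 else 0))"
  using \<open>n \<le> CARD('d)\<close>
proof (induction n)
  case 0
  show ?case by (rule exI[of _ "{}"]) simp
next
  case (Suc n)
  then obtain S where S: "finite S" "card S = n"
    and on: "\<And>s t. s \<in> S \<Longrightarrow> t \<in> S \<Longrightarrow> s \<bullet> (\<omega> *v t) = (if s = t then 1 else 0)"
    by auto
  have sym: "x \<bullet> (\<omega> *v y) = y \<bullet> (\<omega> *v x)" for x y
    using pd unfolding positive_definite_def
    by (metis dot_lmul_matrix inner_commute vector_transpose_matrix)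
  \<comment> \<open>Fewer than d vectors cannot span, which leaves room for a new direction.\<close>
  have "dim S < DIM(real^'d)"
    using dim_le_card'[OF S(1)] S(2) Suc.prems by simp
  then have "span S \<noteq> UNIV"
    by (metis dim_UNIV dim_span nat_neq_iff)
  then obtain x where x: "x \<notin> span S" by auto
  \<comment> \<open>The new vector minus its \<omega>-orthogonal projection to the span of
    \<open>S\<close>; it is nonzero because \<open>x\<close> lies outside that span.\<close>
  define y where "y = x - (\<Sum>s\<in>S. (s \<bullet> (\<omega> *v x)) *\<^sub>R s)"
  have "y \<noteq> 0"
  proof
    assume "y = 0"
    then have "x = (\<Sum>s\<in>S. (s \<bullet> (\<omega> *v x)) *\<^sub>R s)" by (simp add: y_def)
    also have "\<dots> \<in> span S" by (intro span_sum span_scale span_base)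
    finally show False using x by simp
  qed
  then have pos: "y \<bullet> (\<omega> *v y) > 0" using pd by (simp add: positive_definite_def)
  have orth: "y \<bullet> (\<omega> *v t) = 0" if "t \<in> S" for t
  proof -
    have "(\<Sum>s\<in>S. (s \<bullet> (\<omega> *v x)) * (s \<bullet> (\<omega> *v t)))
        = (\<Sum>s\<in>S. if s = t then t \<bullet> (\<omega> *v x) else 0)"
      by (rule sum.cong) (auto simp: on that)
    then show ?thesis
      using S(1) that sym[of x t] by (simp add: y_def inner_diff_left inner_sum_left)
  qed
  define z where "z = (1 / sqrt (y \<bullet> (\<omega> *v y))) *\<^sub>R y"
  have zz: "z \<bullet> (\<omega> *v z) = 1"
    using pos by (simp add: z_def matrix_vector_mult_scaleR divide_simps)
  have zt: "z \<bullet> (\<omega> *v t) = 0" if "t \<in> S" for t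
    by (simp add: z_def orth that)
  have "z \<notin> S" using zz zt by fastforce
  then have "finite (insert z S) \<and> card (insert z S) = Suc n"
    using S by simp
  moreover have "\<forall>s\<in>insert z S. \<forall>t\<in>insert z S. s \<bullet> (\<omega> *v t) = (if s = t then 1 else 0)"
    using on zz zt sym \<open>z \<notin> S\<close> by auto
  ultimately show ?case by blast
qed

text \<open>If the columns of \<open>M\<close> form an \<omega>-orthonormal basis, then M^T \<omega>
  M = 1, so the inverse of \<open>M\<close> is a factor. This supplies a lattice matrix for a
  prescribed \<omega>.\<close>

lemma gram_factorization:
  fixes \<omega> :: "real^'d^'d"
  assumes pd: "positive_definite \<omega>"
  obtains L :: "real^'d^'d" where "invertible L" "transpose L ** L = \<omega>"
proof -
  obtain S where S: "finite S" "card S = CARD('d)"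
    and on: "\<And>s t. s \<in> S \<Longrightarrow> t \<in> S \<Longrightarrow> s \<bullet> (\<omega> *v t) = (if s = t then 1 else 0)"
    using exists_form_orthonormal[OF pd order_refl] by blast
  obtain g where g: "bij_betw g (UNIV :: 'd set) S"
    using S finite_same_card_bij[of "UNIV :: 'd set" S] by auto
  define M :: "real^'d^'d" where "M = (\<chi> i j. g j $ i)"
  have "(transpose M ** (\<omega> ** M)) $ i $ j = (mat 1 :: real^'d^'d) $ i $ j" for i j
  proof -
    have "(transpose M ** (\<omega> ** M)) $ i $ j = g i \<bullet> (\<omega> *v g j)"
      by (simp add: M_def matrix_matrix_mult_def matrix_vector_mult_def transpose_def inner_vec_def)
    also have "\<dots> = (mat 1 :: real^'d^'d) $ i $ j"
      using g on[of "g i" "g j"] by (auto simp: mat_def bij_betw_def inj_def)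
    finally show ?thesis .
  qed
  then have 1: "transpose M ** (\<omega> ** M) = mat 1"
    by (simp add: vec_eq_iff)
  then have M: "invertible M"
    by (metis invertible_left_inverse matrix_mul_assoc)
  define L where "L = matrix_inv M"
  have r: "M ** L = mat 1" and l: "L ** M = mat 1"
    using M by (simp_all add: L_def matrix_inv_right matrix_inv_left)
  have "transpose L ** L = transpose L ** (transpose M ** (\<omega> ** M)) ** L"
    by (simp add: 1)
  also have "\<dots> = transpose (M ** L) ** \<omega> ** (M ** L)"
    by (simp add: matrix_transpose_mul matrix_mul_assoc)
  finally have "transpose L ** L = \<omega>" by (simp add: r)
  moreover have "invertible L" using r l by (auto simp: invertible_def)
  ultimately show ?thesis using that by blast
qed

section \<open>The cone of positive definite matrices\<close>

lemma positive_definite_mat_1: "positive_definite (mat 1)"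
  by (simp add: positive_definite_def)

lemma positive_definite_add:
  "positive_definite \<omega> \<Longrightarrow> positive_definite \<omega>' \<Longrightarrow> positive_definite (\<omega> + \<omega>')"
  by (simp add: positive_definite_def transpose_add matrix_vector_mult_add_rdistrib
      inner_add_right add_pos_pos)

lemma positive_definite_scaleR:
  "positive_definite \<omega> \<Longrightarrow> c > 0 \<Longrightarrow> positive_definite (c *\<^sub>R \<omega>)"
  by (simp add: positive_definite_def transpose_scalar scaleR_matrix_vector_assoc[symmetric])

text \<open>By Cauchy-Schwarz the form of \<omega> is bounded by its operator norm times the squared
  length, so a larger multiple of the identity outweighs it.\<close>

lemma symmetric_plus_scaled_identity:
  fixes \<omega> :: "real^'d^'d"
  assumes "transpose \<omega> = \<omega>"
  obtains c where "c > 0" "positive_definite (\<omega> + c *\<^sub>R mat 1)"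
proof -
  \<comment> \<open>The summand 1 makes the estimate strict and keeps \<open>c\<close> positive even
    for \<omega> = 0.\<close>
  define c where "c = onorm ((*v) \<omega>) + 1"
  have bl: "bounded_linear ((*v) \<omega>)" by (simp add: linear_linear)
  have c: "c > 0" using onorm_pos_le[OF bl] by (simp add: c_def)
  have "x \<bullet> ((\<omega> + c *\<^sub>R mat 1) *v x) > 0" if "x \<noteq> 0" for x
  proof -
    have "\<bar>x \<bullet> (\<omega> *v x)\<bar> \<le> norm x * norm (\<omega> *v x)"
      by (rule Cauchy_Schwarz_ineq2)
    also have "\<dots> \<le> norm x * (onorm ((*v) \<omega>) * norm x)"
      by (intro mult_left_mono onorm[OF bl]) auto
    also have "\<dots> = onorm ((*v) \<omega>) * (x \<bullet> x)"
      by (simp add: power2_norm_eq_inner[symmetric] power2_eq_square)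
    also have "\<dots> < c * (x \<bullet> x)"
      using that by (simp add: c_def)
    finally show ?thesis
      by (simp add: matrix_vector_mult_add_rdistrib inner_add_right
          scaleR_matrix_vector_assoc[symmetric])
  qed
  moreover have "transpose (\<omega> + c *\<^sub>R mat 1) = \<omega> + c *\<^sub>R mat 1"
    using assms by (simp add: transpose_add transpose_scalar)
  ultimately show ?thesis
    using that c by (simp add: positive_definite_def)
qed

section \<open>The parameter space\<close>

lemma subspace_parameter_space: "subspace (parameter_space i0)"
  by (auto simp: subspace_def parameter_space_def transpose_def vec_eq_iff zero_prod_def)

text \<open>This is a coordinate subspace, so its dimension is the number of standard basis vectors
  whose outer index differs from \<open>i0\<close>.\<close>

lemma dim_vanishing_component:
  "dim {t :: real^'d^'n. t $ i0 = 0} = CARD('d) * (CARD('n) - 1)"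
proof -
  define D :: "(real^'d^'n) set" where "D = (\<lambda>(i, j). axis i (axis j 1)) ` ((UNIV - {i0}) \<times> UNIV)"
  have "D \<subseteq> Basis" by (auto simp: D_def Basis_vec_def)
  moreover have "{t :: real^'d^'n. t $ i0 = 0} = {t. \<forall>b\<in>Basis. b \<notin> D \<longrightarrow> t \<bullet> b = 0}"
    (is "_ = ?R")
  proof -
    have "(axis i (axis j 1) :: real^'d^'n) \<in> D \<longleftrightarrow> i \<noteq> i0" for i j
      by (auto simp: D_def image_iff axis_eq_axis)
    then have "?R = {t. \<forall>j. t $ i0 $ j = 0}"
      by (auto simp: Basis_vec_def inner_axis) 
    also have "\<dots> = {t. t $ i0 = 0}" by (simp add: vec_eq_iff)
    finally show ?thesis by simp
  qed
  moreover have "card D = CARD('d) * (CARD('n) - 1)"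
    unfolding D_def by (subst card_image) (auto simp: inj_on_def axis_eq_axis card_Diff_singleton)
  ultimately show ?thesis
    using dim_substandard[of D] by simp
qed

text \<open>The set and its mirror image cover the square and meet exactly in the diagonal, by
  injectivity of \<open>r\<close>. The numbering \<open>r\<close> replaces a linear order on the
  index type.\<close>

lemma card_pairs_le:
  fixes r :: "'d::finite \<Rightarrow> nat"
  assumes "inj r"
  shows "2 * card {(i, j). r i \<le> r j} = CARD('d) * CARD('d) + CARD('d)"
proof -
  let ?P = "{(i, j). r i \<le> r j}"
  have "card ?P = card (prod.swap ` ?P)"
    by (simp add: card_image)
  moreover have "card ?P + card (prod.swap ` ?P)
      = card (?P \<union> prod.swap ` ?P) + card (?P \<inter> prod.swap ` ?P)"
    by (rule card_Un_Int) auto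
  moreover have "?P \<union> prod.swap ` ?P = UNIV"
    by (force simp: image_iff)
  moreover have "?P \<inter> prod.swap ` ?P = (\<lambda>i. (i, i)) ` UNIV"
    using assms by (force simp: image_iff inj_def)
  moreover have "card ((\<lambda>i. (i, i)) ` (UNIV :: 'd set)) = CARD('d)"
    by (simp add: card_image inj_on_def)
  ultimately show ?thesis
    by (simp add: card_prod mult_2)
qed

text \<open>A symmetric matrix is determined by its entries on and above the diagonal, where "above"
  refers to an arbitrary numbering \<open>r\<close> of the indices. Triangular matrices form a
  coordinate subspace, whose dimension can be counted, and reflection in the diagonal is a linear
  isomorphism from it onto the symmetric matrices.\<close>

lemma dim_symmetric_matrices:
  "dim {\<omega> :: real^'d^'d. transpose \<omega> = \<omega>} = CARD('d) + (CARD('d) choose 2)"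
proof -
  obtain r :: "'d \<Rightarrow> nat" where r: "inj r"
    using finite_imp_inj_to_nat_seg[of "UNIV :: 'd set"] by auto
  define D :: "(real^'d^'d) set" where "D = (\<lambda>(i, j). axis i (axis j 1)) ` {(i, j). r i \<le> r j}"
  define U :: "(real^'d^'d) set" where "U = {t. \<forall>b\<in>Basis. b \<notin> D \<longrightarrow> t \<bullet> b = 0}"
  have "(axis i (axis j 1) :: real^'d^'d) \<in> D \<longleftrightarrow> r i \<le> r j" for i j
    by (auto simp: D_def image_iff axis_eq_axis)
  then have U: "U = {t. \<forall>i j. r j < r i \<longrightarrow> t $ i $ j = 0}"
    by (auto simp: U_def Basis_vec_def inner_axis not_le)
  have "D \<subseteq> Basis" by (auto simp: D_def Basis_vec_def)
  then have "dim U = card D" unfolding U_def by (rule dim_substandard)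
  also have "\<dots> = card {(i, j). r i \<le> r j}"
    unfolding D_def by (rule card_image) (auto simp: inj_on_def axis_eq_axis)
  also have "\<dots> = CARD('d) + (CARD('d) choose 2)"
  proof -
    \<comment> \<open>This turns the doubled count d * d + d into twice d + (d choose 2).\<close>
    have "2 * (n choose 2) + n = n * n" for n :: nat
      by (cases n) (simp_all add: choose_two)
    from this[of "CARD('d)"] show ?thesis
      using card_pairs_le[OF r] by linarith
  qed
  finally have dU: "dim U = CARD('d) + (CARD('d) choose 2)" .
  \<comment> \<open>Mirrors the upper triangle into the lower one; on \<open>U\<close> nothing is
    lost, since the overwritten entries vanish.\<close>
  define f :: "real^'d^'d \<Rightarrow> real^'d^'d"
    where "f A = (\<chi> i j. if r i \<le> r j then A $ i $ j else A $ j $ i)" for A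
  have lin: "linear f"
    by (rule linearI) (auto simp: f_def vec_eq_iff)
  have sub: "subspace U" by (auto simp: U subspace_def)
  have inj: "inj_on f U"
  proof (rule inj_onI)
    fix A B assume A: "A \<in> U" and B: "B \<in> U" and eq: "f A = f B"
    have "A $ i $ j = B $ i $ j" for i j
    proof (cases "r i \<le> r j")
      case True
      then show ?thesis using arg_cong[OF eq, of "\<lambda>M. M $ i $ j"] by (simp add: f_def)
    next
      case False
      then show ?thesis using A B by (simp add: U)
    qed
    then show "A = B" by (simp add: vec_eq_iff)
  qed
  have "f ` U = {\<omega> :: real^'d^'d. transpose \<omega> = \<omega>}"
  proof (intro equalityI subsetI)
    fix \<omega> assume "\<omega> \<in> f ` U"
    then show "\<omega> \<in> {\<omega>. transpose \<omega> = \<omega>}"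
      using r by (auto simp: f_def transpose_def vec_eq_iff inj_def) (metis le_antisym nat_le_linear)+
  next
    fix \<omega> :: "real^'d^'d" assume "\<omega> \<in> {\<omega>. transpose \<omega> = \<omega>}"
    then have s: "\<omega> $ i $ j = \<omega> $ j $ i" for i j
      by (auto simp: transpose_def vec_eq_iff)
    define A :: "real^'d^'d" where "A = (\<chi> i j. if r i \<le> r j then \<omega> $ i $ j else 0)"
    have "A \<in> U" by (auto simp: A_def U)
    moreover have "f A = \<omega>" using s by (auto simp: f_def A_def vec_eq_iff)
    ultimately show "\<omega> \<in> f ` U" by blast
  qed
  then show ?thesis
    using dim_image_eq[OF lin, of U] inj sub dU by (simp add: span_eq_iff[THEN iffD2])
qed

text \<open>The d diagonal entries of \<omega> make up for the d coordinates lost by the condition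
  at \<open>i0\<close>.\<close>

lemma dim_parameter_space:
  fixes i0 :: "'n::finite"
  shows "dim (parameter_space i0 :: ('d::finite, 'n) params set)
     = CARD('d) * CARD('n) + (CARD('d) choose 2)"
proof -
  have "parameter_space i0 = {t :: real^'d^'n. t $ i0 = 0} \<times> {\<omega> :: real^'d^'d. transpose \<omega> = \<omega>}"
    by (auto simp: parameter_space_def)
  moreover have "dim ({t :: real^'d^'n. t $ i0 = 0} \<times> {\<omega> :: real^'d^'d. transpose \<omega> = \<omega>})
     = CARD('d) * (CARD('n) - 1) + (CARD('d) + (CARD('d) choose 2))"
    by (subst dim_Times)
      (auto simp: dim_vanishing_component dim_symmetric_matrices subspace_def transpose_add transpose_scalar)
  moreover have "CARD('n) > 0" by simp
  then have "CARD('d) * (CARD('n) - 1) + CARD('d) = CARD('d) * CARD('n)"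
    by (metis Suc_pred' add.commute mult_Suc_right)
  ultimately show ?thesis by simp
qed

text \<open>A plain difference of domain points would have coefficient sum 0 and would lose the
  translation part of an affine map. The third point restores the sum 1, so identities between
  affine maps extend from the domain to the whole space.\<close>

lemma parameter_space_combination:
  assumes "x \<in> parameter_space i0"
  obtains a b c where "a \<in> parameter_domain i0" "b \<in> parameter_domain i0" "c \<in> parameter_domain i0"
    "x = a - b + c"
proof -
  obtain t \<omega> where x: "x = (t, \<omega>)" "t $ i0 = 0" "transpose \<omega> = \<omega>"
    using assms by (auto simp: parameter_space_def)
  obtain k where k: "k > 0" "positive_definite (\<omega> + k *\<^sub>R mat 1)"
    using symmetric_plus_scaled_identity[OF x(3)] .
  show ?thesis
  proof (rule that)
    \<comment> \<open>The first point carries \<open>t\<close> and makes \<omega> positive; the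
      other two remove the excess, as k - (k + 1) + 1 = 0.\<close>
    show "(t, \<omega> + k *\<^sub>R mat 1) \<in> parameter_domain i0"
      "(0, (k + 1) *\<^sub>R mat 1) \<in> parameter_domain i0" "(0, mat 1) \<in> parameter_domain i0"
      using x k by (simp_all add: parameter_domain_def positive_definite_mat_1 positive_definite_scaleR)
    show "x = (t, \<omega> + k *\<^sub>R mat 1) - (0, (k + 1) *\<^sub>R mat 1) + (0, mat 1)"
      by (simp add: x algebra_simps)
  qed
qed

section \<open>The parameter domain as a convex cone\<close>

lemma parameter_domain_subset: "parameter_domain i0 \<subseteq> parameter_space i0"
  by (auto simp: parameter_domain_def parameter_space_def positive_definite_def)

lemma parameter_domain_add:
  "x \<in> parameter_domain i0 \<Longrightarrow> y \<in> parameter_domain i0 \<Longrightarrow> x + y \<in> parameter_domain i0"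
  by (auto simp: parameter_domain_def positive_definite_add)

lemma parameter_domain_scaleR:
  "x \<in> parameter_domain i0 \<Longrightarrow> c > 0 \<Longrightarrow> c *\<^sub>R x \<in> parameter_domain i0"
  by (auto simp: parameter_domain_def positive_definite_scaleR)

text \<open>The induction starts at a singleton because the cone does not contain the
  origin.\<close>

lemma parameter_domain_sum:
  "finite H \<Longrightarrow> H \<noteq> {} \<Longrightarrow> (\<And>h. h \<in> H \<Longrightarrow> f h \<in> parameter_domain i0)
    \<Longrightarrow> sum f H \<in> parameter_domain i0"
  by (induction rule: finite_ne_induct) (auto intro: parameter_domain_add)

text \<open>The weights sum to one, so averaging reproduces the constant \<open>c\<close>.\<close>

lemma affine_average:
  assumes "linear L" "finite H" "H \<noteq> {}"
  shows "L ((1 / real (card H)) *\<^sub>R sum g H) + c = (1 / real (card H)) *\<^sub>R (\<Sum>h\<in>H. L (g h) + c)"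
proof -
  have "(1 / real (card H)) *\<^sub>R (\<Sum>h\<in>H. c) = c"
    using assms by (simp add: sum_constant_scaleR)
  then show ?thesis
    using assms by (simp add: linear_scale linear_sum sum.distrib scaleR_add_right)
qed

section \<open>Automorphism groups\<close>

text \<open>The universal property of a surjective homomorphism: since \<open>h\<close> is constant
  on the fibres of \<open>f\<close>, any choice of preimages defines the factor. It serves both the
  quotient by \<Gamma> and the group of induced multigraph automorphisms.\<close>

lemma hom_factor:
  assumes f: "f \<in> hom G H" "f ` carrier G = carrier H" and h: "h \<in> hom G K"
    and eq: "\<And>x y. x \<in> carrier G \<Longrightarrow> y \<in> carrier G \<Longrightarrow> f x = f y \<Longrightarrow> h x = h y"
    and G: "monoid G"
  shows "\<exists>k\<in>hom H K. \<forall>x\<in>carrier G. h x = k (f x)"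
proof -
  define k where "k y = h (inv_into (carrier G) f y)" for y
  have k: "k (f x) = h x" if "x \<in> carrier G" for x
    unfolding k_def using that by (intro eq) (auto simp: f_inv_into_f inv_into_into)
  have "k \<in> hom H K"
  proof (rule homI)
    fix y assume "y \<in> carrier H"
    then obtain x where x: "x \<in> carrier G" "y = f x" using f(2) by auto
    then show "k y \<in> carrier K" using h by (auto simp: k hom_def)
  next
    fix y z assume "y \<in> carrier H" "z \<in> carrier H"
    then obtain x w where x: "x \<in> carrier G" "y = f x" "w \<in> carrier G" "z = f w"
      using f(2) by (metis imageE)
    then show "k (y \<otimes>\<^bsub>H\<^esub> z) = k y \<otimes>\<^bsub>K\<^esub> k z"
      using hom_mult[OF f(1)] hom_mult[OF h] monoid.m_closed[OF G] by (metis k)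
  qed
  then show ?thesis by (rule bexI[rotated]) (simp add: k)
qed

lemma restrict_UNIV: "restrict f UNIV = f"
  by (simp add: restrict_def)

lemma carrier_graph_Aut:
  "f \<in> carrier (graph_Aut E) \<longleftrightarrow> bij f \<and> (\<forall>u w. {u, w} \<in> E \<longleftrightarrow> {f u, f w} \<in> E)"
  by (auto simp: graph_Aut_def Bij_def)

lemma group_graph_Aut: "group (graph_Aut E)"
proof -
  have "subgroup {f \<in> Bij UNIV. \<forall>u w. {u, w} \<in> E \<longleftrightarrow> {f u, f w} \<in> E} (BijGroup UNIV)"
  proof (rule group.subgroupI[OF group_BijGroup])
    fix f assume f: "f \<in> {f \<in> Bij UNIV. \<forall>u w. {u, w} \<in> E \<longleftrightarrow> {f u, f w} \<in> E}"
    then have "bij f" by (simp add: Bij_def)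
    then show "inv\<^bsub>BijGroup UNIV\<^esub> f \<in> {f \<in> Bij UNIV. \<forall>u w. {u, w} \<in> E \<longleftrightarrow> {f u, f w} \<in> E}"
      using f by (auto simp: inv_BijGroup Bij_def bij_imp_bij_inv bij_inv_eq_iff)
        (metis bij_inv_eq_iff)+
  qed (auto simp: BijGroup_def Bij_def bij_betw_compose compose_def bij_comp[unfolded comp_def]
      bij_id[unfolded id_def] intro!: exI[of _ "\<lambda>x. x"])
  then show ?thesis
    unfolding graph_Aut_def by (rule group.subgroup_imp_group[OF group_BijGroup])
qed

lemma mult_graph_Aut:
  "f \<in> carrier (graph_Aut E) \<Longrightarrow> g \<in> carrier (graph_Aut E) \<Longrightarrow> f \<otimes>\<^bsub>graph_Aut E\<^esub> g = f \<circ> g"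
  by (simp add: carrier_graph_Aut) (simp add: graph_Aut_def BijGroup_def Bij_def compose_def comp_def restrict_UNIV)

lemma one_graph_Aut: "\<one>\<^bsub>graph_Aut E\<^esub> = id"
  by (simp add: graph_Aut_def BijGroup_def id_def restrict_UNIV)

lemma inv_graph_Aut:
  assumes "f \<in> carrier (graph_Aut E)"
  shows "inv\<^bsub>graph_Aut E\<^esub> f = inv_into UNIV f"
proof -
  let ?G = "graph_Aut E"
  interpret group ?G by (rule group_graph_Aut)
  have "inv\<^bsub>?G\<^esub> f \<circ> f = id"
    using assms l_inv inv_closed by (metis mult_graph_Aut one_graph_Aut)
  moreover have "f \<circ> inv\<^bsub>?G\<^esub> f = id"
    using assms r_inv inv_closed by (metis mult_graph_Aut one_graph_Aut)
  ultimately show ?thesis by (metis inv_unique_comp)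
qed

text \<open>Elements of \<open>BijGroup\<close> are controlled only on their carrier sets, so the
  incidence conditions pass to identity, inverses and products once origins and reversals of darts
  stay inside these sets.\<close>

lemma group_multigraph_Aut:
  assumes "\<And>a. a \<in> mdarts Q \<Longrightarrow> morigin Q a \<in> mverts Q"
    and "\<And>a. a \<in> mdarts Q \<Longrightarrow> mrev Q a \<in> mdarts Q"
  shows "group (multigraph_Aut Q)"
proof -
  let ?B = "BijGroup (mverts Q) \<times>\<times> BijGroup (mdarts Q)"
  let ?S = "{(f, g). f \<in> Bij (mverts Q) \<and> g \<in> Bij (mdarts Q) \<and>
        (\<forall>a\<in>mdarts Q. morigin Q (g a) = f (morigin Q a) \<and> mrev Q (g a) = g (mrev Q a))}"
  interpret group ?B by (intro DirProd_group group_BijGroup)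
  have "subgroup ?S ?B"
  proof (rule subgroupI)
    show "?S \<subseteq> carrier ?B" by (auto simp: DirProd_def BijGroup_def)
    have "(\<lambda>x\<in>mverts Q. x, \<lambda>x\<in>mdarts Q. x) \<in> ?S"
      using assms by (auto simp: id_Bij)
    then show "?S \<noteq> {}" by blast
  next
    fix h assume "h \<in> ?S"
    then obtain f g where h: "h = (f, g)" and f: "f \<in> Bij (mverts Q)" and g: "g \<in> Bij (mdarts Q)"
      and c: "\<And>a. a \<in> mdarts Q \<Longrightarrow> morigin Q (g a) = f (morigin Q a)"
        "\<And>a. a \<in> mdarts Q \<Longrightarrow> mrev Q (g a) = g (mrev Q a)" by auto
    let ?f = "inv_into (mverts Q) f" and ?g = "inv_into (mdarts Q) g"
    have bf: "bij_betw f (mverts Q) (mverts Q)" and bg: "bij_betw g (mdarts Q) (mdarts Q)"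
      using f g by (auto simp: Bij_def)
    \<comment> \<open>The conditions for the inverse at \<open>a\<close> are those for
      \<open>(f, g)\<close> at the preimage \<open>b\<close> of \<open>a\<close>.\<close>
    have *: "morigin Q (?g a) = ?f (morigin Q a) \<and> mrev Q (?g a) = ?g (mrev Q a)
        \<and> ?g a \<in> mdarts Q" if a: "a \<in> mdarts Q" for a
    proof -
      define b where "b = ?g a"
      have b: "b \<in> mdarts Q" "g b = a"
        using a bg by (auto simp: b_def bij_betw_def inv_into_into f_inv_into_f)
      have "?f (morigin Q a) = morigin Q b"
        using b c bf assms(1) by (metis bij_betw_inv_into_left)
      moreover have "?g (mrev Q a) = mrev Q b"
        using b c bg assms(2) by (metis bij_betw_inv_into_left)
      ultimately show ?thesis using b by (simp add: b_def)
    qed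
    have "inv\<^bsub>?B\<^esub> h = (restrict ?f (mverts Q), restrict ?g (mdarts Q))"
    proof -
      have "f \<in> carrier (BijGroup (mverts Q))" "g \<in> carrier (BijGroup (mdarts Q))"
        using f g by (simp_all add: BijGroup_def)
      then show ?thesis
        using f g by (simp add: h inv_DirProd group_BijGroup inv_BijGroup)
    qed
    then show "inv\<^bsub>?B\<^esub> h \<in> ?S"
      using f g * assms by (auto simp: restrict_inv_into_Bij)
  next
    fix h k assume "h \<in> ?S" "k \<in> ?S"
    then obtain f g f' g' where "h = (f, g)" "k = (f', g')" "(f, g) \<in> ?S" "(f', g') \<in> ?S"
      by auto
    moreover from this have "g' a \<in> mdarts Q" if "a \<in> mdarts Q" for a
      using Bij_imp_funcset[of g' "mdarts Q"] that by auto
    ultimately show "h \<otimes>\<^bsub>?B\<^esub> k \<in> ?S"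
      using assms by (auto simp: BijGroup_def compose_Bij compose_eq)
  qed
  then show ?thesis
    unfolding multigraph_Aut_def by (rule subgroup_imp_group)
qed

section \<open>The normalizer of \<Gamma> as a group of vertex bijections\<close>

locale vertex_group =
  fixes E :: "'v set set" and \<Gamma> :: "('v \<Rightarrow> 'v) set"
  assumes sub: "subgroup \<Gamma> (graph_Aut E)"
begin

abbreviation "N \<equiv> carrier (periodic_Aut E \<Gamma>)"

lemma \<Gamma>_carrier: "\<gamma> \<in> \<Gamma> \<Longrightarrow> \<gamma> \<in> carrier (graph_Aut E)"
  using sub subgroup.mem_carrier by metis

lemma id_\<Gamma>: "id \<in> \<Gamma>"
  using subgroup.one_closed[OF sub] by (simp add: one_graph_Aut)

lemma comp_\<Gamma>: "\<gamma> \<in> \<Gamma> \<Longrightarrow> \<delta> \<in> \<Gamma> \<Longrightarrow> \<gamma> \<circ> \<delta> \<in> \<Gamma>"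
  using subgroup.m_closed[OF sub] by (metis \<Gamma>_carrier mult_graph_Aut)

lemma inv_\<Gamma>: "\<gamma> \<in> \<Gamma> \<Longrightarrow> inv_into UNIV \<gamma> \<in> \<Gamma>"
  using subgroup.m_inv_closed[OF sub] by (metis \<Gamma>_carrier inv_graph_Aut)

lemma bij_\<Gamma>: "\<gamma> \<in> \<Gamma> \<Longrightarrow> bij \<gamma>"
  using \<Gamma>_carrier by (auto simp: carrier_graph_Aut)

text \<open>Translates the coset form of the normalizer condition into composition of functions, in
  which all later computations take place.\<close>

lemma N_iff: "\<sigma> \<in> N \<longleftrightarrow> \<sigma> \<in> carrier (graph_Aut E) \<and> (\<lambda>\<gamma>. \<sigma> \<circ> \<gamma> \<circ> inv_into UNIV \<sigma>) ` \<Gamma> = \<Gamma>"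
proof -
  let ?G = "graph_Aut E"
  interpret group ?G by (rule group_graph_Aut)
  have "\<sigma> <#\<^bsub>?G\<^esub> \<Gamma> #>\<^bsub>?G\<^esub> (inv\<^bsub>?G\<^esub> \<sigma>) = (\<lambda>\<gamma>. \<sigma> \<circ> \<gamma> \<circ> inv_into UNIV \<sigma>) ` \<Gamma>"
    if s: "\<sigma> \<in> carrier ?G"
  proof -
    have "\<sigma> <#\<^bsub>?G\<^esub> \<Gamma> #>\<^bsub>?G\<^esub> (inv\<^bsub>?G\<^esub> \<sigma>)
        = (\<lambda>\<gamma>. (\<sigma> \<otimes>\<^bsub>?G\<^esub> \<gamma>) \<otimes>\<^bsub>?G\<^esub> inv\<^bsub>?G\<^esub> \<sigma>) ` \<Gamma>"
      by (auto simp: l_coset_def r_coset_def)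
    also have "\<dots> = (\<lambda>\<gamma>. \<sigma> \<circ> \<gamma> \<circ> inv_into UNIV \<sigma>) ` \<Gamma>"
      using s \<Gamma>_carrier m_closed inv_closed
      by (intro image_cong) (metis mult_graph_Aut inv_graph_Aut)+
    finally show ?thesis .
  qed
  moreover have "\<Gamma> \<subseteq> carrier ?G" using \<Gamma>_carrier by auto
  ultimately show ?thesis
    by (auto simp: periodic_Aut_def normalizer_def stabilizer_def)
qed

lemma group_N: "group (periodic_Aut E \<Gamma>)"
  unfolding periodic_Aut_def
  by (intro group.subgroup_imp_group[OF group_graph_Aut] group.normalizer_imp_subgroup[OF group_graph_Aut]
      subgroup.subset sub)

lemma normal_\<Gamma>: "normal \<Gamma> (periodic_Aut E \<Gamma>)"
  unfolding periodic_Aut_def by (rule group.subgroup_in_normalizer[OF group_graph_Aut sub])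

lemma N_carrier: "\<sigma> \<in> N \<Longrightarrow> \<sigma> \<in> carrier (graph_Aut E)"
  by (simp add: N_iff)

lemma bij_N: "\<sigma> \<in> N \<Longrightarrow> bij \<sigma>"
  using N_carrier by (auto simp: carrier_graph_Aut)

lemma \<Gamma>_subset_N: "\<Gamma> \<subseteq> N"
  using normal.axioms(1)[OF normal_\<Gamma>] subgroup.subset by blast

lemma mult_N: "\<sigma> \<in> N \<Longrightarrow> \<tau> \<in> N \<Longrightarrow> \<sigma> \<otimes>\<^bsub>periodic_Aut E \<Gamma>\<^esub> \<tau> = \<sigma> \<circ> \<tau>"
  using mult_graph_Aut[OF N_carrier N_carrier] by (simp add: periodic_Aut_def)

lemma one_N: "\<one>\<^bsub>periodic_Aut E \<Gamma>\<^esub> = id"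
  by (simp add: periodic_Aut_def one_graph_Aut)

lemma id_N: "id \<in> N"
  using monoid.one_closed[OF group.is_monoid[OF group_N]] by (simp add: one_N)

lemma comp_N: "\<sigma> \<in> N \<Longrightarrow> \<tau> \<in> N \<Longrightarrow> \<sigma> \<circ> \<tau> \<in> N"
  using monoid.m_closed[OF group.is_monoid[OF group_N]] by (metis mult_N)

lemma inv_mult_N:
  assumes "\<sigma> \<in> N"
  shows "inv\<^bsub>periodic_Aut E \<Gamma>\<^esub> \<sigma> = inv_into UNIV \<sigma>"
proof -
  let ?G = "periodic_Aut E \<Gamma>"
  interpret group ?G by (rule group_N)
  have "inv\<^bsub>?G\<^esub> \<sigma> \<circ> \<sigma> = id"
    using assms l_inv inv_closed by (metis mult_N one_N)
  moreover have "\<sigma> \<circ> inv\<^bsub>?G\<^esub> \<sigma> = id"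
    using assms r_inv inv_closed by (metis mult_N one_N)
  ultimately show ?thesis by (metis inv_unique_comp)
qed

lemma inv_N: "\<sigma> \<in> N \<Longrightarrow> inv_into UNIV \<sigma> \<in> N"
  using group.inv_closed[OF group_N] by (metis inv_mult_N)

lemma comp_inv_N: "\<sigma> \<in> N \<Longrightarrow> \<sigma> \<circ> inv_into UNIV \<sigma> = id"
  and inv_comp_N: "\<sigma> \<in> N \<Longrightarrow> inv_into UNIV \<sigma> \<circ> \<sigma> = id"
  using bij_N by (auto simp: bij_def surj_iff inj_iff)

lemma inv_inv_N: "\<sigma> \<in> N \<Longrightarrow> inv_into UNIV (inv_into UNIV \<sigma>) = \<sigma>"
  by (simp add: bij_N inv_inv_eq)

lemma conj_\<Gamma>: "\<sigma> \<in> N \<Longrightarrow> \<gamma> \<in> \<Gamma> \<Longrightarrow> \<sigma> \<circ> \<gamma> \<circ> inv_into UNIV \<sigma> \<in> \<Gamma>"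
  unfolding N_iff by blast

lemma conj_inv_\<Gamma>: "\<sigma> \<in> N \<Longrightarrow> \<gamma> \<in> \<Gamma> \<Longrightarrow> inv_into UNIV \<sigma> \<circ> \<gamma> \<circ> \<sigma> \<in> \<Gamma>"
  using conj_\<Gamma>[OF inv_N] by (simp add: inv_inv_N)

text \<open>Moving \<sigma> past \<gamma> costs a conjugation, which stays in \<Gamma>. Hence
  \<sigma> maps orbits into orbits; the companion below, with the inverse conjugation, gives
  onto.\<close>

lemma commute_N:
  assumes "\<sigma> \<in> N" "\<gamma> \<in> \<Gamma>"
  obtains \<delta> where "\<delta> \<in> \<Gamma>" "\<And>x. \<sigma> (\<gamma> x) = \<delta> (\<sigma> x)"
proof (rule that[OF conj_\<Gamma>[OF assms]])
  show "\<sigma> (\<gamma> x) = (\<sigma> \<circ> \<gamma> \<circ> inv_into UNIV \<sigma>) (\<sigma> x)" for x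
    using bij_N[OF assms(1)] by (simp add: bij_is_inj)
qed

lemma commute_N':
  assumes "\<sigma> \<in> N" "\<gamma> \<in> \<Gamma>"
  obtains \<delta> where "\<delta> \<in> \<Gamma>" "\<And>x. \<gamma> (\<sigma> x) = \<sigma> (\<delta> x)"
proof (rule that[OF conj_inv_\<Gamma>[OF assms]])
  show "\<gamma> (\<sigma> x) = \<sigma> ((inv_into UNIV \<sigma> \<circ> \<gamma> \<circ> \<sigma>) x)" for x
    using bij_N[OF assms(1)] by (simp add: bij_is_surj surj_f_inv_f)
qed

subsection \<open>Action on the quotient multigraph\<close>

lemma vertex_orbit_eq: "vertex_orbit E \<Gamma> x = (\<lambda>\<gamma>. \<gamma> x) ` \<Gamma>"
  by (auto simp: vertex_orbit_def orbit_def)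

lemma vertex_orbits_eq: "vertex_orbits E \<Gamma> = range (vertex_orbit E \<Gamma>)"
  by (auto simp: vertex_orbit_def vertex_orbits_def orbits_def)

definition dart_orbit :: "'v \<times> 'v \<Rightarrow> ('v \<times> 'v) set" where
  "dart_orbit a = (\<lambda>\<gamma>. map_prod \<gamma> \<gamma> a) ` \<Gamma>"

lemma dart_orbits_eq: "dart_orbits E \<Gamma> = dart_orbit ` {(u, w). {u, w} \<in> E}"
  by (auto simp: dart_orbits_def orbits_def orbit_def dart_orbit_def image_iff) blast+

lemma image_vertex_orbit:
  assumes "\<sigma> \<in> N"
  shows "\<sigma> ` vertex_orbit E \<Gamma> x = vertex_orbit E \<Gamma> (\<sigma> x)"
proof (intro equalityI subsetI)
  fix y assume "y \<in> \<sigma> ` vertex_orbit E \<Gamma> x"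
  then show "y \<in> vertex_orbit E \<Gamma> (\<sigma> x)"
    using commute_N[OF assms] by (auto simp: vertex_orbit_eq) (metis imageI)
next
  fix y assume "y \<in> vertex_orbit E \<Gamma> (\<sigma> x)"
  then show "y \<in> \<sigma> ` vertex_orbit E \<Gamma> x"
    using commute_N'[OF assms] by (auto simp: vertex_orbit_eq) (metis imageI)
qed

lemma image_dart_orbit:
  assumes "\<sigma> \<in> N"
  shows "map_prod \<sigma> \<sigma> ` dart_orbit a = dart_orbit (map_prod \<sigma> \<sigma> a)"
proof (intro equalityI subsetI)
  fix y assume "y \<in> map_prod \<sigma> \<sigma> ` dart_orbit a"
  then obtain \<gamma> where \<gamma>: "\<gamma> \<in> \<Gamma>" "y = map_prod \<sigma> \<sigma> (map_prod \<gamma> \<gamma> a)"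
    unfolding dart_orbit_def image_image by (rule imageE)
  obtain \<delta> where "\<delta> \<in> \<Gamma>" "\<And>x. \<sigma> (\<gamma> x) = \<delta> (\<sigma> x)" using commute_N[OF assms \<gamma>(1)] by metis
  then show "y \<in> dart_orbit (map_prod \<sigma> \<sigma> a)" using \<gamma> by (cases a) (auto simp: dart_orbit_def)
next
  fix y assume "y \<in> dart_orbit (map_prod \<sigma> \<sigma> a)"
  then obtain \<gamma> where \<gamma>: "\<gamma> \<in> \<Gamma>" "y = map_prod \<gamma> \<gamma> (map_prod \<sigma> \<sigma> a)"
    by (auto simp only: dart_orbit_def)
  obtain \<delta> where "\<delta> \<in> \<Gamma>" "\<And>x. \<gamma> (\<sigma> x) = \<sigma> (\<delta> x)" using commute_N'[OF assms \<gamma>(1)] by metis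
  then have "y = map_prod \<sigma> \<sigma> (map_prod \<delta> \<delta> a)" using \<gamma> by (cases a) auto
  then show "y \<in> map_prod \<sigma> \<sigma> ` dart_orbit a" using \<open>\<delta> \<in> \<Gamma>\<close> by (auto simp: dart_orbit_def)
qed

lemma image_in_vertex_orbits: "\<sigma> \<in> N \<Longrightarrow> a \<in> vertex_orbits E \<Gamma> \<Longrightarrow> \<sigma> ` a \<in> vertex_orbits E \<Gamma>"
  by (auto simp: vertex_orbits_eq image_vertex_orbit)

lemma image_in_dart_orbits:
  assumes "\<sigma> \<in> N" "a \<in> dart_orbits E \<Gamma>"
  shows "map_prod \<sigma> \<sigma> ` a \<in> dart_orbits E \<Gamma>"
proof -
  obtain u w where a: "a = dart_orbit (u, w)" "{u, w} \<in> E"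
    using assms(2) by (auto simp: dart_orbits_eq)
  then have "map_prod \<sigma> \<sigma> ` a = dart_orbit (\<sigma> u, \<sigma> w)"
    by (simp only: image_dart_orbit[OF assms(1)]) simp
  moreover have "{\<sigma> u, \<sigma> w} \<in> E"
    using a(2) N_carrier[OF assms(1)] by (simp add: carrier_graph_Aut)
  ultimately show ?thesis by (auto simp: dart_orbits_eq)
qed

lemma quotient_multigraph_closed:
  assumes "a \<in> dart_orbits E \<Gamma>"
  shows "fst ` a \<in> vertex_orbits E \<Gamma>" "prod.swap ` a \<in> dart_orbits E \<Gamma>"
proof -
  obtain u w where a: "a = dart_orbit (u, w)" "{u, w} \<in> E"
    using assms by (auto simp: dart_orbits_eq)
  have "fst ` a = vertex_orbit E \<Gamma> u"
    by (auto simp: a dart_orbit_def vertex_orbit_eq image_image)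
  then show "fst ` a \<in> vertex_orbits E \<Gamma>" by (simp add: vertex_orbits_eq)
  have "prod.swap ` a = dart_orbit (w, u)"
    by (auto simp: a dart_orbit_def image_image)
  moreover have "{w, u} \<in> E" using a(2) by (simp add: insert_commute)
  ultimately show "prod.swap ` a \<in> dart_orbits E \<Gamma>" by (auto simp: dart_orbits_eq)
qed

abbreviation "M \<equiv> multigraph_Aut (quotient_multigraph E \<Gamma>)"

lemma group_M: "group M"
  by (rule group_multigraph_Aut) (simp_all add: quotient_multigraph_def quotient_multigraph_closed)

lemma quotient_action_mult_eq:
  assumes "\<sigma> \<in> N" "\<tau> \<in> N"
  shows "compose (vertex_orbits E \<Gamma>) (fst (quotient_action E \<Gamma> \<sigma>)) (fst (quotient_action E \<Gamma> \<tau>))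
      = fst (quotient_action E \<Gamma> (\<sigma> \<circ> \<tau>))"
    and "compose (dart_orbits E \<Gamma>) (snd (quotient_action E \<Gamma> \<sigma>)) (snd (quotient_action E \<Gamma> \<tau>))
      = snd (quotient_action E \<Gamma> (\<sigma> \<circ> \<tau>))"
  using image_in_vertex_orbits[OF assms(2)] image_in_dart_orbits[OF assms(2)]
  by (auto simp: compose_def quotient_action_def fun_eq_iff image_comp map_prod_compose[symmetric])

lemma quotient_action_Bij:
  assumes "\<sigma> \<in> N"
  shows "fst (quotient_action E \<Gamma> \<sigma>) \<in> Bij (vertex_orbits E \<Gamma>)"
    and "snd (quotient_action E \<Gamma> \<sigma>) \<in> Bij (dart_orbits E \<Gamma>)"
proof -
  let ?\<tau> = "inv_into UNIV \<sigma>"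
  have \<tau>: "?\<tau> \<in> N" using assms by (rule inv_N)
  have "?\<tau> ` \<sigma> ` A = A" "\<sigma> ` ?\<tau> ` A = A" for A
    using comp_inv_N[OF assms] inv_comp_N[OF assms] by (metis image_comp image_id id_apply)+
  then have "bij_betw (fst (quotient_action E \<Gamma> \<sigma>)) (vertex_orbits E \<Gamma>) (vertex_orbits E \<Gamma>)"
    using image_in_vertex_orbits[OF assms] image_in_vertex_orbits[OF \<tau>]
    by (intro bij_betw_byWitness[where f' = "\<lambda>a. ?\<tau> ` a"]) (auto simp: quotient_action_def)
  then show "fst (quotient_action E \<Gamma> \<sigma>) \<in> Bij (vertex_orbits E \<Gamma>)"
    by (simp add: Bij_def quotient_action_def)
  have "map_prod ?\<tau> ?\<tau> ` map_prod \<sigma> \<sigma> ` A = A" "map_prod \<sigma> \<sigma> ` map_prod ?\<tau> ?\<tau> ` A = A" for A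
    using comp_inv_N[OF assms] inv_comp_N[OF assms]
    by (simp_all add: image_comp map_prod_compose[symmetric] map_prod.id)
  then have "bij_betw (snd (quotient_action E \<Gamma> \<sigma>)) (dart_orbits E \<Gamma>) (dart_orbits E \<Gamma>)"
    using image_in_dart_orbits[OF assms] image_in_dart_orbits[OF \<tau>]
    by (intro bij_betw_byWitness[where f' = "\<lambda>a. map_prod ?\<tau> ?\<tau> ` a"]) (auto simp: quotient_action_def)
  then show "snd (quotient_action E \<Gamma> \<sigma>) \<in> Bij (dart_orbits E \<Gamma>)"
    by (simp add: Bij_def quotient_action_def)
qed

lemma quotient_action_hom: "quotient_action E \<Gamma> \<in> hom (periodic_Aut E \<Gamma>) M"
proof (rule homI)
  fix \<sigma> assume s: "\<sigma> \<in> N"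
  have "fst ` map_prod \<sigma> \<sigma> ` a = \<sigma> ` fst ` a" "prod.swap ` map_prod \<sigma> \<sigma> ` a = map_prod \<sigma> \<sigma> ` prod.swap ` a" for a
    by (force simp: image_iff)+
  then show "quotient_action E \<Gamma> \<sigma> \<in> carrier M"
    using quotient_action_Bij[OF s] image_in_dart_orbits[OF s]
    by (simp add: multigraph_Aut_def quotient_multigraph_def quotient_action_def quotient_multigraph_closed)
next
  fix \<sigma> \<tau> assume s: "\<sigma> \<in> N" and t: "\<tau> \<in> N"
  obtain f g f' g' where q: "quotient_action E \<Gamma> \<sigma> = (f, g)" "quotient_action E \<Gamma> \<tau> = (f', g')"
    by (metis surj_pair)
  have "quotient_action E \<Gamma> (\<sigma> \<circ> \<tau>) = (compose (vertex_orbits E \<Gamma>) f f', compose (dart_orbits E \<Gamma>) g g')"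
    using quotient_action_mult_eq[OF s t] by (simp add: q prod_eq_iff)
  then show "quotient_action E \<Gamma> (\<sigma> \<otimes>\<^bsub>periodic_Aut E \<Gamma>\<^esub> \<tau>)
      = quotient_action E \<Gamma> \<sigma> \<otimes>\<^bsub>M\<^esub> quotient_action E \<Gamma> \<tau>"
    using quotient_action_Bij[OF s] quotient_action_Bij[OF t] s t
    by (simp add: mult_N q multigraph_Aut_def quotient_multigraph_def BijGroup_def)
qed

end

section \<open>Lattices\<close>

text \<open>The coordinates of an element of the free Abelian group in its standard basis, made real
  so that the lattice matrix can be applied to them.\<close>

definition int_vector :: "('d::finite \<Rightarrow>\<^sub>0 int) \<Rightarrow> real^'d" where
  "int_vector k = (\<chi> j. of_int (Poly_Mapping.lookup k j))"

lemma int_vector_simps [simp]: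
  "int_vector 0 = 0" "int_vector (k + l) = int_vector k + int_vector l"
  "int_vector (k - l) = int_vector k - int_vector l" "int_vector (frag_of j) = axis j 1"
  by (simp_all add: int_vector_def vec_eq_iff lookup_add lookup_minus axis_def)

lemma int_vector_eq_iff [simp]: "int_vector k = int_vector l \<longleftrightarrow> k = l"
proof
  assume "int_vector k = int_vector l"
  then show "k = l" by (intro poly_mapping_eqI) (simp add: int_vector_def vec_eq_iff)
qed simp

text \<open>The columns of \<open>L\<close> are the basis required by
  \<open>full_lattice\<close>.\<close>

lemma full_lattice_matrix_image:
  fixes L :: "real^'d^'d"
  assumes "invertible L"
  shows "full_lattice (range (\<lambda>k. L *v int_vector k))"
proof -
  let ?b = "\<lambda>j. L *v axis j 1"
  have inj: "inj ((*v) L)" using assms by (simp add: invertible_eq_bij bij_def)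
  have surj: "range ((*v) L) = UNIV" using assms by (simp add: invertible_eq_bij bij_def)
  have b_inj: "inj ?b"
    by (rule injI) (drule injD[OF inj], simp add: axis_eq_axis)
  have B: "range ?b = (*v) L ` Basis" by (auto simp: Basis_vec_def)
  have "independent (range ?b)"
    unfolding B using inj
    by (intro linear_independent_injective_image independent_Basis) (auto intro: inj_on_subset)
  moreover have "span (range ?b) = UNIV"
    unfolding B by (simp add: linear_span_image surj)
  moreover have "range (\<lambda>k. L *v int_vector k)
      = {\<Sum>b\<in>range ?b. of_int (k b) *\<^sub>R b | k :: real^'d \<Rightarrow> int. True}" (is "_ = ?R")
  proof -
    have expand: "L *v int_vector m = (\<Sum>j\<in>UNIV. of_int (Poly_Mapping.lookup m j) *\<^sub>R ?b j)" for m
    proof -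
      have "int_vector m = (\<Sum>j\<in>UNIV. of_int (Poly_Mapping.lookup m j) *\<^sub>R axis j 1)"
        using basis_expansion[of "int_vector m"] by (simp add: int_vector_def scalar_mult_eq_scaleR)
      then show ?thesis
        by (simp add: linear_sum linear_scale)
    qed
    have reindex: "(\<Sum>b\<in>range ?b. of_int (k b) *\<^sub>R b) = (\<Sum>j\<in>UNIV. of_int (k (?b j)) *\<^sub>R ?b j)"
      for k :: "real^'d \<Rightarrow> int"
      using b_inj by (simp add: sum.reindex)
    show ?thesis
    proof (intro equalityI subsetI)
      fix x assume "x \<in> range (\<lambda>k. L *v int_vector k)"
      then obtain m where "x = L *v int_vector m" by auto
      \<comment> \<open>\<open>full_lattice\<close> indexes coefficients by vectors, so they are
        transported along the injective map from indices to columns.\<close>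
      also have "\<dots> = (\<Sum>b\<in>range ?b. of_int (Poly_Mapping.lookup m (inv_into UNIV ?b b)) *\<^sub>R b)"
        by (simp only: reindex expand inv_f_f[OF b_inj])
      finally show "x \<in> ?R"
        by (intro CollectI exI[of _ "\<lambda>b. Poly_Mapping.lookup m (inv_into UNIV ?b b)"] conjI TrueI)
    next
      fix x assume "x \<in> ?R"
      then obtain k :: "real^'d \<Rightarrow> int" where "x = (\<Sum>b\<in>range ?b. of_int (k b) *\<^sub>R b)" by blast
      also have "\<dots> = L *v int_vector (Abs_poly_mapping (\<lambda>j. k (?b j)))"
        by (simp only: reindex expand) simp
      finally show "x \<in> range (\<lambda>k. L *v int_vector k)" by blast
    qed
  qed
  ultimately show ?thesis unfolding full_lattice_def by blast
qed

text \<open>The lattice contains its own basis. This is what makes the lattice matrix of a placement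
  invertible.\<close>

lemma full_lattice_spans:
  assumes "full_lattice L"
  shows "span L = UNIV"
proof -
  obtain B where B: "independent B" "span B = UNIV"
    "L = {\<Sum>b\<in>B. of_int (k b) *\<^sub>R b | k :: real^'a \<Rightarrow> int. True}"
    using assms by (auto simp: full_lattice_def)
  have fin: "finite B" using B(1) by (rule independent_imp_finite)
  have "b \<in> L" if "b \<in> B" for b
  proof -
    have "(\<Sum>c\<in>B. of_int (if c = b then 1 else 0) *\<^sub>R c) = (\<Sum>c\<in>B. if c = b then b else 0)"
      by (rule sum.cong) auto
    also have "\<dots> = b" using fin that by simp
    finally have "b = (\<Sum>c\<in>B. of_int (if c = b then 1 else 0) *\<^sub>R c)" ..
    then show ?thesis unfolding B(3)
      by (intro CollectI exI[of _ "\<lambda>c. if c = b then 1 else 0"]) simp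
  qed
  then have "span B \<subseteq> span L" by (intro span_mono) auto
  then show ?thesis using B(2) by auto
qed

section \<open>Periodic graphs with chosen parameters\<close>

text \<open>Outside \<open>S\<close> such a function has a fixed default value, so finiteness does
  not depend on the ambient type.\<close>

lemma finite_Bij: "finite S \<Longrightarrow> finite (Bij S)"
  by (rule finite_subset[OF _ finite_PiE[of S "\<lambda>_. S"]])
    (auto simp: PiE_def Bij_imp_extensional dest: Bij_imp_funcset)

locale periodic_params = vertex_group E \<Gamma> for E :: "'v set set" and \<Gamma> +
  fixes \<phi> :: "('d::finite \<Rightarrow>\<^sub>0 int) \<Rightarrow> ('v \<Rightarrow> 'v)" and v :: "'n::finite \<Rightarrow> 'v" and i0 :: 'n
  assumes connected: "connected_graph E"
    and free: "\<And>\<gamma> x. \<gamma> \<in> \<Gamma> \<Longrightarrow> \<gamma> x = x \<Longrightarrow> \<gamma> = id"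
    and finite_quotient: "finite_multigraph (quotient_multigraph E \<Gamma>)"
    and \<phi>_iso: "\<phi> \<in> iso (free_Abelian_group UNIV) (subgroup_of_Aut E \<Gamma>)"
    and reps: "bij_betw (\<lambda>i. vertex_orbit E \<Gamma> (v i)) UNIV (vertex_orbits E \<Gamma>)"
begin

text \<open>The quotient of \<gamma> by \<delta> has the fixed point \<open>x\<close>.\<close>

lemma free_eq:
  assumes "\<gamma> \<in> \<Gamma>" "\<delta> \<in> \<Gamma>" "\<gamma> x = \<delta> x"
  shows "\<gamma> = \<delta>"
proof -
  have "(inv_into UNIV \<delta> \<circ> \<gamma>) x = x"
    using assms bij_\<Gamma>[of \<delta>] by (simp add: bij_is_inj)
  then have "inv_into UNIV \<delta> \<circ> \<gamma> = id"
    using free comp_\<Gamma> inv_\<Gamma> assms by metis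
  then have "\<delta> \<circ> (inv_into UNIV \<delta> \<circ> \<gamma>) = \<delta>" by simp
  moreover have "\<delta> \<circ> (inv_into UNIV \<delta> \<circ> \<gamma>) = \<gamma>"
    using bij_\<Gamma>[OF assms(2)] by (simp add: fun_eq_iff bij_is_surj surj_f_inv_f)
  ultimately show ?thesis by simp
qed

lemma comp_image_\<Gamma>:
  assumes "\<gamma> \<in> \<Gamma>"
  shows "(\<lambda>\<delta>. \<delta> \<circ> \<gamma>) ` \<Gamma> = \<Gamma>"
proof (intro equalityI subsetI)
  fix \<delta> assume "\<delta> \<in> \<Gamma>"
  then have "\<delta> \<circ> inv_into UNIV \<gamma> \<in> \<Gamma>" using comp_\<Gamma> inv_\<Gamma> assms by blast
  moreover have "\<delta> = (\<delta> \<circ> inv_into UNIV \<gamma>) \<circ> \<gamma>"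
    using bij_\<Gamma>[OF assms] by (simp add: fun_eq_iff bij_is_inj)
  ultimately show "\<delta> \<in> (\<lambda>\<delta>. \<delta> \<circ> \<gamma>) ` \<Gamma>" by blast
qed (use comp_\<Gamma> assms in auto)

lemma vertex_orbit_\<Gamma>:
  assumes "\<gamma> \<in> \<Gamma>"
  shows "vertex_orbit E \<Gamma> (\<gamma> x) = vertex_orbit E \<Gamma> x"
  using arg_cong[OF comp_image_\<Gamma>[OF assms], of "(`) (\<lambda>\<delta>. \<delta> x)"]
  by (simp add: vertex_orbit_eq image_image)

lemma dart_orbit_\<Gamma>:
  assumes "\<gamma> \<in> \<Gamma>"
  shows "dart_orbit (map_prod \<gamma> \<gamma> a) = dart_orbit a"
  using arg_cong[OF comp_image_\<Gamma>[OF assms], of "(`) (\<lambda>\<delta>. map_prod \<delta> \<delta> a)"]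
  by (simp add: dart_orbit_def image_image map_prod.compositionality)

lemma quotient_action_\<Gamma>:
  assumes "\<gamma> \<in> \<Gamma>"
  shows "quotient_action E \<Gamma> \<gamma> = quotient_action E \<Gamma> id"
proof -
  have N: "\<gamma> \<in> N" using assms \<Gamma>_subset_N by blast
  have "\<gamma> ` a = id ` a" if "a \<in> vertex_orbits E \<Gamma>" for a
    using that unfolding vertex_orbits_eq
    by (elim imageE) (simp add: image_vertex_orbit[OF N] vertex_orbit_\<Gamma>[OF assms])
  moreover have "map_prod \<gamma> \<gamma> ` a = map_prod id id ` a" if "a \<in> dart_orbits E \<Gamma>" for a
    using that unfolding dart_orbits_eq
    by (elim imageE) (simp add: image_dart_orbit[OF N] dart_orbit_\<Gamma>[OF assms] map_prod.id)
  ultimately show ?thesis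
    unfolding quotient_action_def by (intro arg_cong2[of _ _ _ _ Pair] restrict_ext)
qed

text \<open>An automorphism preserving all dart orbits agrees with one and the same element of
  \<open>\<Gamma>\<close> along every edge, by freeness, hence everywhere, by connectedness.\<close>

lemma quotient_action_kernel:
  assumes s: "\<sigma> \<in> N" and eq: "quotient_action E \<Gamma> \<sigma> = quotient_action E \<Gamma> id"
  shows "\<sigma> \<in> \<Gamma>"
proof -
  obtain x :: 'v where True by simp
  have "\<sigma> ` vertex_orbit E \<Gamma> x = vertex_orbit E \<Gamma> x"
    using fun_cong[OF arg_cong[OF eq, of fst], of "vertex_orbit E \<Gamma> x"]
    by (simp add: quotient_action_def vertex_orbits_eq)
  then have "\<sigma> x \<in> vertex_orbit E \<Gamma> x"
    using id_\<Gamma> by (auto simp: vertex_orbit_eq) (metis id_apply imageI)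
  then obtain \<gamma> where \<gamma>: "\<gamma> \<in> \<Gamma>" "\<sigma> x = \<gamma> x" by (auto simp: vertex_orbit_eq)
  have "\<sigma> y = \<gamma> y" for y
  proof -
    have "(x, y) \<in> {(u, w). {u, w} \<in> E}\<^sup>*" using connected by (simp add: connected_graph_def)
    then show ?thesis
    proof (induction rule: rtrancl_induct)
      case (step y w)
      have "dart_orbit (y, w) \<in> dart_orbits E \<Gamma>" using step.hyps(2) by (auto simp: dart_orbits_eq)
      then have "map_prod \<sigma> \<sigma> ` dart_orbit (y, w) = dart_orbit (y, w)"
        using fun_cong[OF arg_cong[OF eq, of snd], of "dart_orbit (y, w)"]
        by (simp add: quotient_action_def map_prod.id)
      moreover have "(y, w) \<in> dart_orbit (y, w)"
        using imageI[OF id_\<Gamma>, of "\<lambda>\<gamma>. map_prod \<gamma> \<gamma> (y, w)"] by (simp add: dart_orbit_def)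
      ultimately have "map_prod \<sigma> \<sigma> (y, w) \<in> dart_orbit (y, w)" by blast
      then obtain \<delta> where "\<delta> \<in> \<Gamma>" "\<sigma> y = \<delta> y" "\<sigma> w = \<delta> w" by (auto simp: dart_orbit_def)
      then show ?case using free_eq[of \<delta> \<gamma> y] \<gamma> step.IH by metis
    qed (rule \<gamma>(2))
  qed
  then show ?thesis using \<gamma>(1) by (metis ext)
qed

text \<open>Only the induced automorphisms: one of the quotient multigraph need not lift. If
  integers at distance 1 or 2 are joined, the quotient has two loops, and no automorphism
  normalizing the translations exchanges them.\<close>

abbreviation "Q \<equiv> M\<lparr>carrier := quotient_action E \<Gamma> ` N\<rparr>"

lemma subgroup_Q: "subgroup (quotient_action E \<Gamma> ` N) M"
  by (intro group_hom.img_is_subgroup group_hom.intro group_hom_axioms.intro group_N group_M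
      quotient_action_hom)

lemma group_Q: "group Q"
  by (rule group.subgroup_imp_group[OF group_M subgroup_Q])

lemma quotient_action_hom_Q: "quotient_action E \<Gamma> \<in> hom (periodic_Aut E \<Gamma>) Q"
  using quotient_action_hom by (simp add: hom_def)

lemma kernel_Q: "kernel (periodic_Aut E \<Gamma>) Q (quotient_action E \<Gamma>) = \<Gamma>"
proof -
  have "quotient_action E \<Gamma> id = \<one>\<^bsub>M\<^esub>"
    using hom_one[OF quotient_action_hom group_N group_M] by (simp add: one_N)
  then show ?thesis
    using quotient_action_kernel quotient_action_\<Gamma> \<Gamma>_subset_N by (auto simp: kernel_def)
qed

lemma iso_Q:
  "\<exists>\<iota> \<in> iso (periodic_Aut E \<Gamma> Mod \<Gamma>) Q.
     \<forall>\<sigma> \<in> N. \<iota> (\<Gamma> #>\<^bsub>periodic_Aut E \<Gamma>\<^esub> \<sigma>) = quotient_action E \<Gamma> \<sigma>"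
proof -
  interpret group_hom "periodic_Aut E \<Gamma>" Q "quotient_action E \<Gamma>"
    by (intro group_hom.intro group_hom_axioms.intro group_N group_Q quotient_action_hom_Q)
  let ?\<iota> = "\<lambda>X. the_elem (quotient_action E \<Gamma> ` X)"
  have "?\<iota> \<in> iso (periodic_Aut E \<Gamma> Mod \<Gamma>) Q"
    using FactGroup_iso_set by (simp add: kernel_Q)
  moreover have "?\<iota> (\<Gamma> #>\<^bsub>periodic_Aut E \<Gamma>\<^esub> \<sigma>) = quotient_action E \<Gamma> \<sigma>" if s: "\<sigma> \<in> N" for \<sigma>
  proof -
    \<comment> \<open>Elements of a coset differ by members of the kernel, so the image is a
      singleton and \<open>the_elem\<close> can be evaluated.\<close>
    have "quotient_action E \<Gamma> ` (\<Gamma> #>\<^bsub>periodic_Aut E \<Gamma>\<^esub> \<sigma>) = {quotient_action E \<Gamma> \<sigma>}"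
    proof -
      have "quotient_action E \<Gamma> (\<gamma> \<otimes>\<^bsub>periodic_Aut E \<Gamma>\<^esub> \<sigma>) = quotient_action E \<Gamma> \<sigma>" if "\<gamma> \<in> \<Gamma>" for \<gamma>
      proof -
        have "\<gamma> \<in> N" using that \<Gamma>_subset_N by blast
        moreover have "quotient_action E \<Gamma> \<gamma> = \<one>\<^bsub>Q\<^esub>"
          using that kernel_Q by (auto simp: kernel_def)
        ultimately show ?thesis using s hom_closed[OF s] by (simp only: hom_mult H.l_one)
      qed
      moreover have "\<Gamma> #>\<^bsub>periodic_Aut E \<Gamma>\<^esub> \<sigma> = (\<lambda>\<gamma>. \<gamma> \<otimes>\<^bsub>periodic_Aut E \<Gamma>\<^esub> \<sigma>) ` \<Gamma>"
        by (auto simp: r_coset_def)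
      ultimately show ?thesis using id_\<Gamma> by (simp add: image_image image_constant_conv) blast
    qed
    then show ?thesis by simp
  qed
  ultimately show ?thesis by (intro bexI[of _ ?\<iota>] ballI)
qed

lemma finite_Q: "finite (quotient_action E \<Gamma> ` N)"
proof (rule finite_subset)
  show "quotient_action E \<Gamma> ` N \<subseteq> Bij (vertex_orbits E \<Gamma>) \<times> Bij (dart_orbits E \<Gamma>)"
    using quotient_action_Bij by (intro image_subsetI) (simp add: mem_Times_iff)
  show "finite (Bij (vertex_orbits E \<Gamma>) \<times> Bij (dart_orbits E \<Gamma>))"
    using finite_quotient by (simp add: finite_multigraph_def quotient_multigraph_def finite_Bij)
qed

section \<open>The action on placements\<close>

lemma placement_action_eq:
  assumes "\<sigma> \<in> N"
  shows "placement_action \<Gamma> \<sigma> (p, \<pi>)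
    = (p \<circ> inv_into UNIV \<sigma>, \<lambda>\<gamma>\<in>\<Gamma>. \<pi> (inv_into UNIV \<sigma> \<circ> \<gamma> \<circ> \<sigma>))"
  by (auto simp: placement_action_def conj_aut_def inv_inv_N[OF assms] fun_eq_iff)

lemma conj_inv_image_\<Gamma>:
  assumes "\<sigma> \<in> N"
  shows "(\<lambda>\<gamma>. inv_into UNIV \<sigma> \<circ> \<gamma> \<circ> \<sigma>) ` \<Gamma> = \<Gamma>"
  using inv_N[OF assms] by (simp add: N_iff inv_inv_N[OF assms])

text \<open>Conjugation permutes \<Gamma>, so the lattice of translations is unchanged as a set and
  only its labelling by \<Gamma> varies. Moving the inverse of \<sigma> past \<gamma> produces the
  same conjugation, which gives equivariance.\<close>

lemma placement_action_closed:
  assumes s: "\<sigma> \<in> N" and P: "P \<in> placements \<Gamma>"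
  shows "placement_action \<Gamma> \<sigma> P \<in> placements \<Gamma>"
proof -
  let ?c = "\<lambda>\<gamma>. inv_into UNIV \<sigma> \<circ> \<gamma> \<circ> \<sigma>"
  obtain p \<pi> where Pe: "P = (p, \<pi>)" by (cases P)
  have \<pi>: "\<And>\<gamma> \<delta>. \<gamma> \<in> \<Gamma> \<Longrightarrow> \<delta> \<in> \<Gamma> \<Longrightarrow> \<pi> (\<gamma> \<circ> \<delta>) = \<pi> \<gamma> + \<pi> \<delta>" "inj_on \<pi> \<Gamma>" "full_lattice (\<pi> ` \<Gamma>)"
    "\<And>\<gamma> x. \<gamma> \<in> \<Gamma> \<Longrightarrow> p (\<gamma> x) = p x + \<pi> \<gamma>"
    using P by (auto simp: Pe placements_def)
  have cc: "?c \<gamma> \<in> \<Gamma>" if "\<gamma> \<in> \<Gamma>" for \<gamma> using conj_inv_\<Gamma>[OF s that] .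
  have sx: "\<sigma> (inv_into UNIV \<sigma> x) = x" for x
    using bij_N[OF s] by (simp add: bij_is_surj surj_f_inv_f)
  have c_comp: "?c (\<gamma> \<circ> \<delta>) = ?c \<gamma> \<circ> ?c \<delta>" for \<gamma> \<delta> by (simp add: fun_eq_iff sx)
  have c_inj: "inj_on ?c \<Gamma>"
  proof (rule inj_onI)
    fix \<gamma> \<delta> assume "?c \<gamma> = ?c \<delta>"
    then have "\<sigma> (?c \<gamma> (inv_into UNIV \<sigma> x)) = \<sigma> (?c \<delta> (inv_into UNIV \<sigma> x))" for x by simp
    then show "\<gamma> = \<delta>" by (simp add: fun_eq_iff sx)
  qed
  define \<pi>' where "\<pi>' = (\<lambda>\<gamma>\<in>\<Gamma>. \<pi> (?c \<gamma>))"
  have "\<pi>' ` \<Gamma> = \<pi> ` (?c ` \<Gamma>)" by (auto simp: \<pi>'_def)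
  then have "full_lattice (\<pi>' ` \<Gamma>)" by (simp only: conj_inv_image_\<Gamma>[OF s] \<pi>(3))
  moreover have "inj_on \<pi>' \<Gamma>"
  proof -
    have "inj_on (\<pi> \<circ> ?c) \<Gamma>"
      using c_inj \<pi>(2) by (intro comp_inj_on) (simp_all only: conj_inv_image_\<Gamma>[OF s])
    then show ?thesis by (simp add: \<pi>'_def inj_on_def)
  qed
  moreover have "\<pi>' (\<gamma> \<circ> \<delta>) = \<pi>' \<gamma> + \<pi>' \<delta>" if "\<gamma> \<in> \<Gamma>" "\<delta> \<in> \<Gamma>" for \<gamma> \<delta>
    using \<pi>(1)[OF cc[OF that(1)] cc[OF that(2)]] that comp_\<Gamma>[OF that]
    by (simp only: \<pi>'_def restrict_apply' c_comp)
  moreover have "(p \<circ> inv_into UNIV \<sigma>) (\<gamma> x) = (p \<circ> inv_into UNIV \<sigma>) x + \<pi>' \<gamma>" if "\<gamma> \<in> \<Gamma>" for \<gamma> x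
    using \<pi>(4)[OF cc[OF that], of "inv_into UNIV \<sigma> x"] that by (simp add: \<pi>'_def sx)
  ultimately have "(p \<circ> inv_into UNIV \<sigma>, \<pi>') \<in> placements \<Gamma>"
    by (auto simp: placements_def) (simp add: \<pi>'_def)
  then show ?thesis by (simp add: Pe placement_action_eq[OF s] \<pi>'_def)
qed

lemma placement_action_comp:
  assumes s: "\<sigma> \<in> N" and t: "\<tau> \<in> N"
  shows "placement_action \<Gamma> (\<sigma> \<circ> \<tau>) P = placement_action \<Gamma> \<sigma> (placement_action \<Gamma> \<tau> P)"
proof -
  have "inv_into UNIV (\<sigma> \<circ> \<tau>) = inv_into UNIV \<tau> \<circ> inv_into UNIV \<sigma>"
    using bij_N[OF s] bij_N[OF t] by (rule o_inv_distrib)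
  then show ?thesis
    using conj_inv_\<Gamma>[OF s]
    by (cases P) (auto simp: placement_action_eq s t comp_N o_assoc intro!: restrict_ext)
qed

text \<open>Here the extensionality required of \<pi> turns agreement on \<Gamma> into
  equality.\<close>

lemma placement_action_id: "P \<in> placements \<Gamma> \<Longrightarrow> placement_action \<Gamma> id P = P"
  by (cases P) (auto simp: placement_action_eq[OF id_N] placements_def extensional_restrict)

lemma placement_action_inv:
  assumes "\<sigma> \<in> N" "P \<in> placements \<Gamma>"
  shows "placement_action \<Gamma> \<sigma> (placement_action \<Gamma> (inv_into UNIV \<sigma>) P) = P"
    and "placement_action \<Gamma> (inv_into UNIV \<sigma>) (placement_action \<Gamma> \<sigma> P) = P"
  using assms by (simp_all add: placement_action_comp[symmetric] inv_N comp_inv_N inv_comp_N placement_action_id)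

lemma group_action_placements:
  "group_action (periodic_Aut E \<Gamma>) (placements \<Gamma> :: ('v, 'b::finite) placement set)
     (\<lambda>\<sigma>. restrict (placement_action \<Gamma> \<sigma>) (placements \<Gamma>))"
proof -
  let ?X = "placements \<Gamma> :: ('v, 'b::finite) placement set"
  have B: "restrict (placement_action \<Gamma> \<sigma>) ?X \<in> Bij ?X" if "\<sigma> \<in> N" for \<sigma>
  proof -
    have "bij_betw (placement_action \<Gamma> \<sigma>) ?X ?X"
      using that inv_N[OF that]
      by (intro bij_betw_byWitness[where f' = "placement_action \<Gamma> (inv_into UNIV \<sigma>)"])
        (auto simp: placement_action_inv placement_action_closed)
    then show ?thesis by (simp add: Bij_def)
  qed
  show ?thesis
    unfolding group_action_def
  proof (intro group_hom.intro group_hom_axioms.intro group_N group_BijGroup homI)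
    fix \<sigma> assume "\<sigma> \<in> N"
    then show "restrict (placement_action \<Gamma> \<sigma>) ?X \<in> carrier (BijGroup ?X)"
      using B by (simp add: BijGroup_def)
  next
    fix \<sigma> \<tau> assume st: "\<sigma> \<in> N" "\<tau> \<in> N"
    then show "restrict (placement_action \<Gamma> (\<sigma> \<otimes>\<^bsub>periodic_Aut E \<Gamma>\<^esub> \<tau>)) ?X
      = restrict (placement_action \<Gamma> \<sigma>) ?X \<otimes>\<^bsub>BijGroup ?X\<^esub> restrict (placement_action \<Gamma> \<tau>) ?X"
      using B by (auto simp: mult_N BijGroup_def compose_def placement_action_comp
          placement_action_closed intro!: restrict_ext)
  qed
qed

section \<open>Placements and parameters\<close>

lemma \<phi>_bij: "bij_betw \<phi> UNIV \<Gamma>"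
  using \<phi>_iso by (auto simp: iso_def free_Abelian_group_def)

lemma \<phi>_in [simp]: "\<phi> k \<in> \<Gamma>"
  using \<phi>_bij by (auto simp: bij_betw_def)

lemma \<phi>_eq_iff [simp]: "\<phi> k = \<phi> l \<longleftrightarrow> k = l"
  using \<phi>_bij by (auto simp: bij_betw_def inj_eq)

lemma \<phi>_surj:
  assumes "\<gamma> \<in> \<Gamma>"
  obtains k where "\<gamma> = \<phi> k"
  using \<phi>_bij assms by (auto simp: bij_betw_def)

lemma \<phi>_add: "\<phi> (k + l) = \<phi> k \<circ> \<phi> l"
proof -
  have "\<phi> (k + l) = \<phi> k \<otimes>\<^bsub>graph_Aut E\<^esub> \<phi> l"
    using \<phi>_iso by (auto simp: iso_def hom_def free_Abelian_group_def)
  then show ?thesis by (simp add: mult_graph_Aut \<Gamma>_carrier)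
qed

text \<open>An additive map on a free Abelian group is determined on the basis, and the values there
  are the columns of the lattice matrix.\<close>

lemma placement_translation:
  assumes "(p, \<pi>) \<in> placements \<Gamma>"
  shows "\<pi> (\<phi> k) = lattice_matrix \<phi> \<pi> *v int_vector k"
proof -
  have add: "\<pi> (\<phi> (k + l)) = \<pi> (\<phi> k) + \<pi> (\<phi> l)" for k l
    using assms by (simp add: placements_def \<phi>_add)
  have "Poly_Mapping.keys k \<subseteq> UNIV" by simp
  then show ?thesis
  proof (induction k rule: frag_induction)
    case zero
    show ?case using add[of 0 0] by simp
  next
    case (one j)
    show ?case by (simp add: lattice_matrix_def matrix_vector_mul_component vec_eq_iff
          inner_axis)
  next
    case (diff a b)
    then show ?case using add[of "a - b" b] by (simp add: matrix_vector_mult_diff_distrib)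
  qed
qed

lemma placement_image:
  assumes "(p, \<pi>) \<in> placements \<Gamma>"
  shows "p (\<phi> k x) = p x + lattice_matrix \<phi> \<pi> *v int_vector k"
  using assms placement_translation[OF assms] by (simp add: placements_def)

text \<open>The range of the matrix is a subspace containing a lattice that spans, so the matrix is
  onto.\<close>

lemma invertible_lattice_matrix:
  assumes "(p, \<pi>) \<in> placements \<Gamma>"
  shows "invertible (lattice_matrix \<phi> \<pi>)"
proof -
  let ?L = "lattice_matrix \<phi> \<pi>"
  have "\<pi> ` \<Gamma> \<subseteq> range ((*v) ?L)"
    by (auto elim!: \<phi>_surj simp: placement_translation[OF assms])
  moreover have "span (\<pi> ` \<Gamma>) = UNIV"
    using assms by (intro full_lattice_spans) (simp add: placements_def)
  moreover have "subspace (range ((*v) ?L))"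
    by (intro linear_subspace_image) auto
  ultimately have "surj ((*v) ?L)" by (metis span_minimal top.extremum_unique)
  then show ?thesis by (simp add: invertible_right_inverse matrix_right_invertible_surjective)
qed

text \<open>Clears the matrix inverse from the definition; later arguments verify parameters in this
  form.\<close>

lemma parameter_point_eq:
  assumes "(p, \<pi>) \<in> placements \<Gamma>"
  shows "parameter_point \<phi> v i0 (p, \<pi>) = (t, \<omega>) \<longleftrightarrow>
    (\<forall>i. lattice_matrix \<phi> \<pi> *v t $ i = p (v i) - p (v i0)) \<and>
    transpose (lattice_matrix \<phi> \<pi>) ** lattice_matrix \<phi> \<pi> = \<omega>"
proof -
  let ?L = "lattice_matrix \<phi> \<pi>"
  have "?L ** matrix_inv ?L = mat 1" "matrix_inv ?L ** ?L = mat 1"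
    using invertible_lattice_matrix[OF assms] by (simp_all add: matrix_inv_right matrix_inv_left)
  then have "matrix_inv ?L *v x = y \<longleftrightarrow> ?L *v y = x" for x y
    by (metis matrix_vector_mul_assoc matrix_vector_mul_lid)
  then show ?thesis
    by (auto simp: parameter_point_def Let_def vec_eq_iff[of _ t])
qed

lemma parameter_point_in_domain:
  assumes "P \<in> placements \<Gamma>"
  shows "parameter_point \<phi> v i0 P \<in> parameter_domain i0"
  using assms positive_definite_gram[OF invertible_lattice_matrix]
  by (cases P) (auto simp: parameter_domain_def parameter_point_def Let_def)

text \<open>Together with the next lemma this identifies vertices with pairs of a lattice element
  and an orbit index, so that positions can be prescribed freely by such pairs.\<close>

lemma vertex_coordinates:
  obtains k i where "x = \<phi> k (v i)"
proof -
  have "vertex_orbit E \<Gamma> x \<in> range (\<lambda>i. vertex_orbit E \<Gamma> (v i))"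
    using reps by (simp add: bij_betw_def vertex_orbits_eq)
  then obtain i where "vertex_orbit E \<Gamma> x = vertex_orbit E \<Gamma> (v i)" by auto
  moreover have "x \<in> vertex_orbit E \<Gamma> x"
    using imageI[OF id_\<Gamma>, of "\<lambda>\<gamma>. \<gamma> x"] by (simp add: vertex_orbit_eq)
  ultimately obtain \<gamma> where "\<gamma> \<in> \<Gamma>" "x = \<gamma> (v i)" by (auto simp: vertex_orbit_eq)
  moreover obtain k where "\<gamma> = \<phi> k" using calculation(1) by (rule \<phi>_surj)
  ultimately show ?thesis using that by blast
qed

lemma vertex_coordinates_unique:
  assumes "\<phi> k (v i) = \<phi> l (v j)"
  shows "k = l \<and> i = j"
proof -
  have "vertex_orbit E \<Gamma> (v i) = vertex_orbit E \<Gamma> (v j)"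
    using vertex_orbit_\<Gamma>[OF \<phi>_in] assms by metis
  then have "i = j" using reps by (auto simp: bij_betw_def inj_def)
  moreover from this have "\<phi> k = \<phi> l" using free_eq[OF \<phi>_in \<phi>_in] assms by blast
  ultimately show ?thesis by simp
qed

text \<open>Factor \<omega> as L^T L and put the vertex with coordinates \<open>k\<close> and
  \<open>i\<close> at \<open>L *v (t $ i + int_vector k)\<close>; the columns of \<open>L\<close>
  are the periods.\<close>

lemma exists_placement:
  assumes "x \<in> parameter_domain i0"
  obtains P where "P \<in> placements \<Gamma>" "parameter_point \<phi> v i0 P = x"
proof -
  obtain t \<omega> where x: "x = (t, \<omega>)" "t $ i0 = 0" "positive_definite \<omega>"
    using assms by (auto simp: parameter_domain_def)
  obtain L :: "real^'d^'d" where L: "invertible L" "transpose L ** L = \<omega>"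
    using gram_factorization[OF x(3)] .
  obtain K I where KI: "\<And>x. x = \<phi> (K x) (v (I x))"
  proof -
    have "\<exists>a. x = \<phi> (fst a) (v (snd a))" for x
      by (rule vertex_coordinates[of x]) auto
    then obtain f where "\<And>x. x = \<phi> (fst (f x)) (v (snd (f x)))" by metis
    then show ?thesis by (rule that)
  qed
  have KI_eq: "K (\<phi> k (v i)) = k" "I (\<phi> k (v i)) = i" for k i
    using vertex_coordinates_unique KI by metis+
  define p where "p x = L *v (t $ I x + int_vector (K x))" for x
  define \<pi> where "\<pi> = (\<lambda>\<gamma>\<in>\<Gamma>. L *v int_vector (inv_into UNIV \<phi> \<gamma>))"
  have \<pi>: "\<pi> (\<phi> k) = L *v int_vector k" for k
    using \<phi>_bij by (simp add: \<pi>_def bij_betw_def)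
  have p: "p (\<phi> k (v i)) = L *v (t $ i + int_vector k)" for k i
    by (simp add: p_def KI_eq)
  have P: "(p, \<pi>) \<in> placements \<Gamma>"
    unfolding placements_def
  proof (intro CollectI case_prodI conjI ballI allI)
    show "\<pi> \<in> extensional \<Gamma>" by (simp add: \<pi>_def)
  next
    fix \<gamma> \<delta> assume "\<gamma> \<in> \<Gamma>" "\<delta> \<in> \<Gamma>"
    then show "\<pi> (\<gamma> \<circ> \<delta>) = \<pi> \<gamma> + \<pi> \<delta>"
      by (elim \<phi>_surj) (simp add: \<pi> matrix_vector_right_distrib flip: \<phi>_add)
  next
    have "inj ((*v) L)" using L(1) by (simp add: invertible_eq_bij bij_def)
    then show "inj_on \<pi> \<Gamma>"
      by (intro inj_onI) (elim \<phi>_surj, simp add: \<pi> inj_eq)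
  next
    have "\<pi> ` \<Gamma> = \<pi> ` range \<phi>" using \<phi>_bij by (simp add: bij_betw_def)
    also have "\<dots> = range (\<lambda>k. L *v int_vector k)" by (simp add: image_image \<pi>)
    finally show "full_lattice (\<pi> ` \<Gamma>)" by (simp add: full_lattice_matrix_image[OF L(1)])
  next
    fix \<gamma> x assume "\<gamma> \<in> \<Gamma>"
    then obtain m where m: "\<gamma> = \<phi> m" by (rule \<phi>_surj)
    obtain k i where x: "x = \<phi> k (v i)" by (rule vertex_coordinates)
    have "\<gamma> x = \<phi> (m + k) (v i)" by (simp add: m x \<phi>_add)
    then show "p (\<gamma> x) = p x + \<pi> \<gamma>"
      by (simp add: p \<pi> m x[symmetric]) (simp add: x p matrix_vector_right_distrib)
  qed
  have LM: "lattice_matrix \<phi> \<pi> = L"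
    by (simp add: lattice_matrix_def \<pi> vec_eq_iff matrix_vector_mul_component inner_axis)
  \<comment> \<open>\<open>\<phi> 0\<close> is idempotent and injective. So each \<open>v i\<close>
    has lattice coordinate 0, and \<open>t $ i0 = 0\<close> puts \<open>v i0\<close> at the
    origin.\<close>
  have "\<phi> 0 = id" using \<phi>_add[of 0 0] free_eq[OF \<phi>_in id_\<Gamma>]
    bij_\<Gamma>[OF \<phi>_in, of 0] by (metis add_0 bij_is_inj comp_apply id_apply injD)
  then have "p (v i) = L *v t $ i" for i using p[of 0 i] by simp
  then have "parameter_point \<phi> v i0 (p, \<pi>) = x"
    using L(2) x by (simp add: parameter_point_eq[OF P] LM)
  with P show ?thesis by (rule that)
qed

text \<open>Equal Gram matrices give an orthogonal map between the two lattice bases, and equal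
  relative positions make it match the orbit representatives, hence all vertices. Conversely, an
  isometry multiplies the lattice matrix by an orthogonal matrix from the left, which cancels from
  both parameters.\<close>

lemma parameter_point_eq_iff:
  assumes "P \<in> placements \<Gamma>" "P' \<in> placements \<Gamma>"
  shows "parameter_point \<phi> v i0 P = parameter_point \<phi> v i0 P' \<longleftrightarrow> isometry_equivalent \<Gamma> P P'"
proof -
  obtain p \<pi> p' \<pi>' where PP': "P = (p, \<pi>)" "P' = (p', \<pi>')" by (metis surj_pair)
  then have P: "(p, \<pi>) \<in> placements \<Gamma>" and P': "(p', \<pi>') \<in> placements \<Gamma>"
    using assms by simp_all
  let ?L = "lattice_matrix \<phi> \<pi>" and ?K = "lattice_matrix \<phi> \<pi>'"
  obtain t \<omega> where t: "parameter_point \<phi> v i0 (p, \<pi>) = (t, \<omega>)" by (metis surj_pair)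
  have L: "\<And>i. ?L *v t $ i = p (v i) - p (v i0)" "transpose ?L ** ?L = \<omega>"
    using t by (simp_all add: parameter_point_eq[OF P])
  have "parameter_point \<phi> v i0 (p', \<pi>') = (t, \<omega>) \<longleftrightarrow> isometry_equivalent \<Gamma> (p, \<pi>) (p', \<pi>')"
  proof
    assume "parameter_point \<phi> v i0 (p', \<pi>') = (t, \<omega>)"
    then have K: "\<And>i. ?K *v t $ i = p' (v i) - p' (v i0)" "transpose ?K ** ?K = \<omega>"
      by (simp_all add: parameter_point_eq[OF P'])
    define U where "U = ?K ** matrix_inv ?L"
    have inv: "invertible ?L" by (rule invertible_lattice_matrix[OF P])
    have "orthogonal_matrix U"
      unfolding U_def by (rule orthogonal_matrix_of_gram_eq) (simp_all add: inv K(2) L(2))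
    then have "orthogonal_transformation ((*v) U)"
      by (simp add: orthogonal_transformation_matrix)
    moreover have UL: "U *v (?L *v y) = ?K *v y" for y
      by (simp add: U_def matrix_vector_mul_assoc matrix_inv_left[OF inv] flip: matrix_mul_assoc)
    \<comment> \<open>The translation is forced by the vertex \<open>v i0\<close>.\<close>
    define c where "c = p' (v i0) - U *v p (v i0)"
    have "p' x = ((\<lambda>x. U *v x + c) \<circ> p) x" for x
    proof -
      obtain k i where x: "x = \<phi> k (v i)" by (rule vertex_coordinates)
      have "U *v (p (v i) - p (v i0)) = p' (v i) - p' (v i0)"
        using K(1)[of i] L(1)[of i] UL by metis
      then show ?thesis
        by (simp add: c_def x placement_image[OF P] placement_image[OF P'] UL
            matrix_vector_right_distrib matrix_vector_mult_diff_distrib algebra_simps)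
    qed
    then have "p' = (\<lambda>x. U *v x + c) \<circ> p" by (rule ext)
    moreover have "\<pi>' = restrict ((*v) U \<circ> \<pi>) \<Gamma>"
    proof (rule extensionalityI)
      show "\<pi>' \<in> extensional \<Gamma>" using P' by (simp add: placements_def)
      fix \<gamma> assume "\<gamma> \<in> \<Gamma>"
      then show "\<pi>' \<gamma> = restrict ((*v) U \<circ> \<pi>) \<Gamma> \<gamma>"
        by (elim \<phi>_surj) (simp add: placement_translation[OF P] placement_translation[OF P'] UL)
    qed simp
    ultimately show "isometry_equivalent \<Gamma> (p, \<pi>) (p', \<pi>')"
      unfolding isometry_equivalent_def
      by (intro exI[of _ "(*v) U"] exI[of _ c]) simp
  next
    assume "isometry_equivalent \<Gamma> (p, \<pi>) (p', \<pi>')"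
    then obtain f c where f: "orthogonal_transformation f"
      and p': "\<And>x. p' x = f (p x) + c" and \<pi>': "\<And>\<gamma>. \<gamma> \<in> \<Gamma> \<Longrightarrow> \<pi>' \<gamma> = f (\<pi> \<gamma>)"
      by (auto simp: isometry_equivalent_def)
    have lin: "linear f" using f by (rule orthogonal_transformation_linear)
    have Km: "?K = matrix f ** ?L"
    proof -
      have "column j ?K = column j (matrix f ** ?L)" for j
      proof -
        have "column j ?K = \<pi>' (\<phi> (frag_of j))" "column j ?L = \<pi> (\<phi> (frag_of j))"
          by (simp_all add: lattice_matrix_def column_def vec_eq_iff)
        moreover have "column j (matrix f ** ?L) = matrix f *v column j ?L"
          by (simp add: column_def matrix_matrix_mult_def matrix_vector_mult_def vec_eq_iff)
        ultimately show ?thesis by (simp add: \<pi>' matrix_works lin)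
      qed
      then show ?thesis by (simp add: column_def vec_eq_iff)
    qed
    have K: "?K *v y = f (?L *v y)" for y
      by (simp add: Km matrix_works lin flip: matrix_vector_mul_assoc)
    have "transpose ?K ** ?K = transpose ?L ** (transpose (matrix f) ** matrix f) ** ?L"
      by (simp add: Km matrix_transpose_mul matrix_mul_assoc)
    also have "transpose (matrix f) ** matrix f = mat 1"
      using f by (simp add: orthogonal_transformation_matrix orthogonal_matrix)
    finally have "transpose ?K ** ?K = \<omega>" by (simp add: L(2))
    then show "parameter_point \<phi> v i0 (p', \<pi>') = (t, \<omega>)"
      by (simp add: parameter_point_eq[OF P'] K L(1) p' linear_diff[OF lin])
  qed
  then show ?thesis by (auto simp: PP' t)
qed

section \<open>The affine representation\<close>

text \<open>Let \<tau> be the inverse of \<sigma>. It sends \<open>v i\<close> to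
  \<open>\<phi> (k i) (v (g i))\<close> and acts on \<Gamma> by conjugation with integral matrix
  \<open>C\<close>. The new lattice matrix is \<Lambda> C, so \<omega> becomes C^T \<omega> C, and
  t_i becomes C^-1 (t_(g i) - t_(g i0) + k_i - k_i0). Neither formula involves \<Lambda>.\<close>

lemma placement_action_affine:
  assumes s: "\<sigma> \<in> N"
  shows "\<exists>F c. linear F \<and> (\<forall>P\<in>placements \<Gamma>.
    parameter_point \<phi> v i0 (placement_action \<Gamma> \<sigma> P) = F (parameter_point \<phi> v i0 P) + c)"
proof -
  let ?\<tau> = "inv_into UNIV \<sigma>"
  \<comment> \<open>The columns of \<open>C\<close>: coordinates of the conjugated basis
    elements.\<close>
  define m where "m j = inv_into UNIV \<phi> (?\<tau> \<circ> \<phi> (frag_of j) \<circ> \<sigma>)" for j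
  have m: "?\<tau> \<circ> \<phi> (frag_of j) \<circ> \<sigma> = \<phi> (m j)" for j
    using \<phi>_bij conj_inv_\<Gamma>[OF s \<phi>_in]
    by (simp only: m_def) (simp add: bij_betw_def f_inv_into_f)
  have "\<exists>a. ?\<tau> (v i) = \<phi> (fst a) (v (snd a))" for i
    by (rule vertex_coordinates[of "?\<tau> (v i)"]) auto
  then obtain a where a: "\<And>i. ?\<tau> (v i) = \<phi> (fst (a i)) (v (snd (a i)))" by metis
  define k where "k i = fst (a i)" for i
  define g where "g i = snd (a i)" for i
  have kg: "?\<tau> (v i) = \<phi> (k i) (v (g i))" for i by (simp add: a k_def g_def)
  define C :: "real^'d^'d" where "C = (\<chi> i j. of_int (Poly_Mapping.lookup (m j) i))"
  define F :: "('d, 'n) params \<Rightarrow> ('d, 'n) params" where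
    "F = (\<lambda>(t, \<omega>). (\<chi> i. matrix_inv C *v (t $ g i - t $ g i0), transpose C ** \<omega> ** C))"
  define c :: "('d, 'n) params" where
    "c = (\<chi> i. matrix_inv C *v (int_vector (k i) - int_vector (k i0)), 0)"
  have "linear F"
    by (rule linearI)
      (auto simp: F_def vec_eq_iff matrix_vector_mult_diff_distrib matrix_vector_right_distrib
        matrix_vector_mult_scaleR matrix_matrix_mult_def sum.distrib sum_distrib_left
        sum_distrib_right algebra_simps)
  moreover have "parameter_point \<phi> v i0 (placement_action \<Gamma> \<sigma> P) = F (parameter_point \<phi> v i0 P) + c"
    if P: "P \<in> placements \<Gamma>" for P
  proof -
    obtain p \<pi> where Pe: "P = (p, \<pi>)" by (cases P)
    have p: "(p, \<pi>) \<in> placements \<Gamma>" using P Pe by simp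
    obtain t \<omega> where t: "parameter_point \<phi> v i0 P = (t, \<omega>)" by (metis surj_pair)
    let ?L = "lattice_matrix \<phi> \<pi>"
    have L: "\<And>i. ?L *v t $ i = p (v i) - p (v i0)" "transpose ?L ** ?L = \<omega>"
      using t by (simp_all add: Pe parameter_point_eq[OF p])
    define p' where "p' = p \<circ> ?\<tau>"
    define \<pi>' where "\<pi>' = (\<lambda>\<gamma>\<in>\<Gamma>. \<pi> (?\<tau> \<circ> \<gamma> \<circ> \<sigma>))"
    have pa: "placement_action \<Gamma> \<sigma> P = (p', \<pi>')"
      by (simp add: Pe placement_action_eq[OF s] p'_def \<pi>'_def)
    then have p'\<pi>': "(p', \<pi>') \<in> placements \<Gamma>" using placement_action_closed[OF s P] by simp
    let ?K = "lattice_matrix \<phi> \<pi>'"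
    have K: "?K = ?L ** C"
    proof -
      have "?K $ i $ j = (?L ** C) $ i $ j" for i j
      proof -
        have "?K $ i $ j = (?L *v int_vector (m j)) $ i"
        proof -
          have "?K $ i $ j = \<pi>' (\<phi> (frag_of j)) $ i" by (simp add: lattice_matrix_def)
          also have "\<pi>' (\<phi> (frag_of j)) = \<pi> (\<phi> (m j))" by (simp only: \<pi>'_def restrict_apply' \<phi>_in m)
          finally show ?thesis by (simp only: placement_translation[OF p])
        qed
        then show ?thesis
          by (simp add: C_def int_vector_def matrix_matrix_mult_def matrix_vector_mult_def)
      qed
      then show ?thesis by (simp add: vec_eq_iff)
    qed
    have invL: "invertible ?L" using p by (rule invertible_lattice_matrix)
    have "(matrix_inv ?K ** ?L) ** C = mat 1"
      using matrix_inv_left[OF invertible_lattice_matrix[OF p'\<pi>']] by (simp add: K matrix_mul_assoc)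
    \<comment> \<open>Invertibility of \<open>C\<close> is read off from a placement: both lattice
      matrices are invertible and differ by the factor \<open>C\<close>.\<close>
    then have "invertible C" by (metis invertible_left_inverse)
    then have C: "C *v (matrix_inv C *v y) = y" for y
      by (simp add: matrix_vector_mul_assoc matrix_inv_right)
    \<comment> \<open>The term \<open>p (v i0)\<close> is common to all \<open>i\<close> and drops
      out of differences.\<close>
    have pv: "p' (v i) = p (v i0) + ?L *v (t $ g i + int_vector (k i))" for i
      using L(1)[of "g i"] by (simp add: p'_def kg placement_image[OF p] matrix_vector_right_distrib)
    have "?K *v (matrix_inv C *v (t $ g i - t $ g i0) + matrix_inv C *v (int_vector (k i) - int_vector (k i0)))
        = p' (v i) - p' (v i0)" for i
      unfolding pv K matrix_vector_mul_assoc[symmetric] matrix_vector_right_distrib C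
      by (simp add: matrix_vector_mult_diff_distrib)
    moreover have "transpose ?K ** ?K = transpose C ** \<omega> ** C"
      by (simp add: K L(2)[symmetric] matrix_transpose_mul matrix_mul_assoc)
    ultimately show ?thesis
      unfolding pa t F_def c_def by (simp add: parameter_point_eq[OF p'\<pi>'])
  qed
  ultimately show ?thesis by blast
qed

section \<open>Construction of the representation and its composition laws\<close>

abbreviation "W \<equiv> parameter_space i0 :: ('d, 'n) params set"
abbreviation "D \<equiv> parameter_domain i0 :: ('d, 'n) params set"

definition linear_part :: "('v \<Rightarrow> 'v) \<Rightarrow> ('d, 'n) params \<Rightarrow> ('d, 'n) params" where
  "linear_part \<sigma> = (SOME F. \<exists>c. linear F \<and> (\<forall>P\<in>placements \<Gamma>.
    parameter_point \<phi> v i0 (placement_action \<Gamma> \<sigma> P) = F (parameter_point \<phi> v i0 P) + c))"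

definition translation_part :: "('v \<Rightarrow> 'v) \<Rightarrow> ('d, 'n) params" where
  "translation_part \<sigma> = (SOME c. \<forall>P\<in>placements \<Gamma>.
    parameter_point \<phi> v i0 (placement_action \<Gamma> \<sigma> P) = linear_part \<sigma> (parameter_point \<phi> v i0 P) + c)"

text \<open>The choices above are constrained only on parameter points, which determine an affine
  map on \<open>W\<close>. Restriction to \<open>W\<close> discards the undetermined rest and makes
  the map an element of \<open>BijGroup W\<close>.\<close>

definition affine_rep :: "('v \<Rightarrow> 'v) \<Rightarrow> ('d, 'n) params \<Rightarrow> ('d, 'n) params" where
  "affine_rep \<sigma> = (\<lambda>x\<in>W. linear_part \<sigma> x + translation_part \<sigma>)"

lemma linear_part: "\<sigma> \<in> N \<Longrightarrow> linear (linear_part \<sigma>)"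
  and affine_rep_parameter_point: "\<sigma> \<in> N \<Longrightarrow> P \<in> placements \<Gamma> \<Longrightarrow>
    affine_rep \<sigma> (parameter_point \<phi> v i0 P) = parameter_point \<phi> v i0 (placement_action \<Gamma> \<sigma> P)"
proof -
  assume s: "\<sigma> \<in> N"
  have *: "\<exists>c. linear (linear_part \<sigma>) \<and> (\<forall>P\<in>placements \<Gamma>.
    parameter_point \<phi> v i0 (placement_action \<Gamma> \<sigma> P) = linear_part \<sigma> (parameter_point \<phi> v i0 P) + c)"
    unfolding linear_part_def using placement_action_affine[OF s] by (rule someI_ex)
  then show "linear (linear_part \<sigma>)" by blast
  have eq: "\<forall>P\<in>placements \<Gamma>. parameter_point \<phi> v i0 (placement_action \<Gamma> \<sigma> P)
      = linear_part \<sigma> (parameter_point \<phi> v i0 P) + translation_part \<sigma>"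
    unfolding translation_part_def by (rule someI_ex) (use * in \<open>elim exE conjE, intro exI\<close>)
  assume P: "P \<in> placements \<Gamma>"
  then have "parameter_point \<phi> v i0 P \<in> W"
    using parameter_point_in_domain parameter_domain_subset by blast
  then show "affine_rep \<sigma> (parameter_point \<phi> v i0 P) = parameter_point \<phi> v i0 (placement_action \<Gamma> \<sigma> P)"
    by (simp only: affine_rep_def restrict_apply' bspec[OF eq P])
qed

text \<open>Positive definiteness is preserved because every domain point comes from a placement and
  placements go to placements.\<close>

lemma affine_rep_domain:
  assumes s: "\<sigma> \<in> N" and x: "x \<in> D"
  shows "affine_rep \<sigma> x \<in> D"
proof -
  obtain P where P: "P \<in> placements \<Gamma>" "parameter_point \<phi> v i0 P = x" using exists_placement[OF x] .
  then show ?thesis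
    using affine_rep_parameter_point[OF s P(1)] parameter_point_in_domain[OF placement_action_closed[OF s P(1)]]
    by simp
qed

lemma affine_rep_combination:
  assumes "\<sigma> \<in> N" "a \<in> W" "b \<in> W" "c \<in> W"
  shows "affine_rep \<sigma> (a - b + c) = affine_rep \<sigma> a - affine_rep \<sigma> b + affine_rep \<sigma> c"
proof -
  have "a - b + c \<in> W"
    using assms by (intro subspace_add subspace_diff subspace_parameter_space)
  then show ?thesis
    using assms by (simp add: affine_rep_def linear_add linear_diff linear_part)
qed

lemma affine_rep_space:
  assumes s: "\<sigma> \<in> N" and x: "x \<in> W"
  shows "affine_rep \<sigma> x \<in> W"
proof -
  obtain a b c where abc: "a \<in> D" "b \<in> D" "c \<in> D" "x = a - b + c"
    using parameter_space_combination[OF x] .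
  then have "affine_rep \<sigma> x = affine_rep \<sigma> a - affine_rep \<sigma> b + affine_rep \<sigma> c"
    using affine_rep_combination[OF s] parameter_domain_subset by blast
  moreover have "affine_rep \<sigma> a \<in> W" "affine_rep \<sigma> b \<in> W" "affine_rep \<sigma> c \<in> W"
    using abc affine_rep_domain[OF s] parameter_domain_subset by blast+
  ultimately show ?thesis
    by (simp add: subspace_add subspace_diff subspace_parameter_space)
qed

lemma affine_rep_comp:
  assumes s: "\<sigma> \<in> N" and t: "\<tau> \<in> N" and x: "x \<in> W"
  shows "affine_rep (\<sigma> \<circ> \<tau>) x = affine_rep \<sigma> (affine_rep \<tau> x)"
proof -
  have on_domain: "affine_rep (\<sigma> \<circ> \<tau>) y = affine_rep \<sigma> (affine_rep \<tau> y)" if y: "y \<in> D" for y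
  proof -
    obtain P where "P \<in> placements \<Gamma>" "parameter_point \<phi> v i0 P = y" using exists_placement[OF y] .
    then show ?thesis
      using s t by (metis affine_rep_parameter_point placement_action_closed placement_action_comp comp_N)
  qed
  obtain a b c where abc: "a \<in> D" "b \<in> D" "c \<in> D" "x = a - b + c"
    using parameter_space_combination[OF x] .
  then have W: "a \<in> W" "b \<in> W" "c \<in> W" using parameter_domain_subset by blast+
  show ?thesis
    by (simp add: abc affine_rep_combination s t W comp_N affine_rep_space on_domain)
qed

text \<open>An element of \<Gamma> shifts all vertices by the same vector, which cancels from
  relative positions, and conjugation by it is trivial because \<Gamma> is commutative.\<close>

lemma affine_rep_\<Gamma>:
  assumes g: "\<gamma> \<in> \<Gamma>" and x: "x \<in> W"
  shows "affine_rep \<gamma> x = x"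
proof -
  have N: "\<gamma> \<in> N" using g \<Gamma>_subset_N by blast
  have on_domain: "affine_rep \<gamma> y = y" if y: "y \<in> D" for y
  proof -
    obtain p \<pi> where P: "(p, \<pi>) \<in> placements \<Gamma>" "parameter_point \<phi> v i0 (p, \<pi>) = y"
      by (rule exists_placement[OF y]) auto
    have closed: "placement_action \<Gamma> \<gamma> (p, \<pi>) \<in> placements \<Gamma>"
      using placement_action_closed[OF N P(1)] .
    have p: "p (inv_into UNIV \<gamma> x) = p x - \<pi> \<gamma>" for x
    proof -
      have "p (\<gamma> (inv_into UNIV \<gamma> x)) = p (inv_into UNIV \<gamma> x) + \<pi> \<gamma>"
        using P(1) g by (simp add: placements_def)
      then show ?thesis using bij_\<Gamma>[OF g] by (simp add: bij_is_surj surj_f_inv_f)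
    qed
    have "\<pi> (inv_into UNIV \<gamma> \<circ> \<delta> \<circ> \<gamma>) = \<pi> \<delta>" if "\<delta> \<in> \<Gamma>" for \<delta>
    proof -
      obtain k where "\<gamma> = \<phi> k" using g by (rule \<phi>_surj)
      moreover obtain l where "\<delta> = \<phi> l" using \<open>\<delta> \<in> \<Gamma>\<close> by (rule \<phi>_surj)
      ultimately have "\<delta> \<circ> \<gamma> = \<gamma> \<circ> \<delta>" by (simp add: add.commute flip: \<phi>_add)
      then have "inv_into UNIV \<gamma> \<circ> \<delta> \<circ> \<gamma> = \<delta>"
        using inv_comp_N[OF N] by (metis comp_assoc id_comp)
      then show ?thesis by simp
    qed
    then have "lattice_matrix \<phi> (\<lambda>\<delta>\<in>\<Gamma>. \<pi> (inv_into UNIV \<gamma> \<circ> \<delta> \<circ> \<gamma>)) = lattice_matrix \<phi> \<pi>"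
      by (simp add: lattice_matrix_def)
    then have "parameter_point \<phi> v i0 (placement_action \<Gamma> \<gamma> (p, \<pi>)) = parameter_point \<phi> v i0 (p, \<pi>)"
      by (simp add: placement_action_eq[OF N] parameter_point_def p)
    then show ?thesis using affine_rep_parameter_point[OF N P(1)] P(2) by simp
  qed
  obtain a b c where abc: "a \<in> D" "b \<in> D" "c \<in> D" "x = a - b + c"
    using parameter_space_combination[OF x] .
  then have "a \<in> W" "b \<in> W" "c \<in> W" using parameter_domain_subset by blast+
  then show ?thesis
    by (simp add: abc affine_rep_combination N on_domain)
qed

lemma affine_rep_inv:
  assumes "\<sigma> \<in> N" "x \<in> W"
  shows "affine_rep \<sigma> (affine_rep (inv_into UNIV \<sigma>) x) = x" "affine_rep (inv_into UNIV \<sigma>) (affine_rep \<sigma> x) = x"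
  using assms
  by (simp_all add: affine_rep_comp[symmetric] inv_N comp_inv_N inv_comp_N affine_rep_\<Gamma>[OF id_\<Gamma>])

lemma affine_rep_Aff: "\<sigma> \<in> N \<Longrightarrow> affine_rep \<sigma> \<in> carrier (Aff W)"
proof -
  assume s: "\<sigma> \<in> N"
  have "bij_betw (affine_rep \<sigma>) W W"
    using s inv_N[OF s]
    by (intro bij_betw_byWitness[where f' = "affine_rep (inv_into UNIV \<sigma>)"]) (auto simp: affine_rep_inv affine_rep_space)
  moreover have "affine_rep \<sigma> \<in> extensional W" by (simp add: affine_rep_def)
  moreover have "\<exists>F c. linear F \<and> (\<forall>x\<in>W. affine_rep \<sigma> x = F x + c)"
    using linear_part[OF s] by (intro exI[of _ "linear_part \<sigma>"] exI[of _ "translation_part \<sigma>"]) (simp add: affine_rep_def)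
  ultimately show ?thesis by (simp add: Aff_def Bij_def)
qed

lemma affine_rep_hom: "affine_rep \<in> hom (periodic_Aut E \<Gamma>) (Aff W)"
proof (rule homI)
  fix \<sigma> \<tau> assume s: "\<sigma> \<in> N" and t: "\<tau> \<in> N"
  have B: "affine_rep \<sigma> \<in> Bij W" "affine_rep \<tau> \<in> Bij W" using affine_rep_Aff s t by (auto simp: Aff_def)
  have "affine_rep (\<sigma> \<circ> \<tau>) = compose W (affine_rep \<sigma>) (affine_rep \<tau>)"
  proof (rule extensionalityI)
    show "affine_rep (\<sigma> \<circ> \<tau>) \<in> extensional W" by (simp add: affine_rep_def)
  qed (simp_all add: compose_eq affine_rep_comp s t)
  then show "affine_rep (\<sigma> \<otimes>\<^bsub>periodic_Aut E \<Gamma>\<^esub> \<tau>) = affine_rep \<sigma> \<otimes>\<^bsub>Aff W\<^esub> affine_rep \<tau>"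
    using B s t by (simp add: mult_N Aff_def BijGroup_def)
qed (rule affine_rep_Aff)

text \<open>The two automorphisms differ by an element of the kernel of the quotient action, that
  is, of \<Gamma>, on which the representation is trivial.\<close>

lemma affine_rep_eq:
  assumes s: "\<sigma> \<in> N" and t: "\<tau> \<in> N" and eq: "quotient_action E \<Gamma> \<sigma> = quotient_action E \<Gamma> \<tau>"
  shows "affine_rep \<sigma> = affine_rep \<tau>"
proof -
  interpret group_hom "periodic_Aut E \<Gamma>" Q "quotient_action E \<Gamma>"
    by (intro group_hom.intro group_hom_axioms.intro group_N group_Q quotient_action_hom_Q)
  let ?\<gamma> = "inv_into UNIV \<tau> \<circ> \<sigma>"
  have "?\<gamma> \<in> N" using s t comp_N inv_N by blast
  moreover have "quotient_action E \<Gamma> ?\<gamma> = quotient_action E \<Gamma> (inv_into UNIV \<tau> \<circ> \<tau>)"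
    using s t eq inv_N[OF t] hom_mult by (metis mult_N)
  ultimately have g: "?\<gamma> \<in> \<Gamma>" by (intro quotient_action_kernel) (simp_all add: inv_comp_N[OF t])
  have "\<sigma> = \<tau> \<circ> ?\<gamma>" using comp_inv_N[OF t] by (metis comp_assoc id_comp)
  then have "affine_rep \<sigma> x = affine_rep \<tau> x" if "x \<in> W" for x
    using affine_rep_comp[OF t _ that, of ?\<gamma>] affine_rep_\<Gamma>[OF g that] \<open>?\<gamma> \<in> N\<close> by metis
  moreover have "affine_rep \<sigma> \<in> extensional W" "affine_rep \<tau> \<in> extensional W" by (simp_all add: affine_rep_def)
  ultimately show ?thesis by (intro extensionalityI)
qed

lemma affine_rep_factors_Mod:
  "\<exists>A' \<in> hom (periodic_Aut E \<Gamma> Mod \<Gamma>) (Aff W).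
     \<forall>\<sigma>\<in>N. affine_rep \<sigma> = A' (\<Gamma> #>\<^bsub>periodic_Aut E \<Gamma>\<^esub> \<sigma>)"
proof (rule hom_factor)
  interpret normal \<Gamma> "periodic_Aut E \<Gamma>" by (rule normal_\<Gamma>)
  show "(#>\<^bsub>periodic_Aut E \<Gamma>\<^esub>) \<Gamma> \<in> hom (periodic_Aut E \<Gamma>) (periodic_Aut E \<Gamma> Mod \<Gamma>)"
    by (rule r_coset_hom_Mod)
  show "(#>\<^bsub>periodic_Aut E \<Gamma>\<^esub>) \<Gamma> ` N = carrier (periodic_Aut E \<Gamma> Mod \<Gamma>)"
    by (auto simp: FactGroup_def RCOSETS_def)
  show "monoid (periodic_Aut E \<Gamma>)" by (rule is_monoid)
  fix \<sigma> \<tau> assume "\<sigma> \<in> N" "\<tau> \<in> N" "\<Gamma> #>\<^bsub>periodic_Aut E \<Gamma>\<^esub> \<sigma> = \<Gamma> #>\<^bsub>periodic_Aut E \<Gamma>\<^esub> \<tau>"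
  moreover obtain \<iota> where "\<forall>\<sigma>\<in>N. \<iota> (\<Gamma> #>\<^bsub>periodic_Aut E \<Gamma>\<^esub> \<sigma>) = quotient_action E \<Gamma> \<sigma>"
    using iso_Q by (elim bexE) (erule that)
  ultimately show "affine_rep \<sigma> = affine_rep \<tau>" by (metis affine_rep_eq)
qed (rule affine_rep_hom)

lemma affine_rep_factors_Q:
  "\<exists>A'' \<in> hom Q (Aff W). \<forall>\<sigma>\<in>N. affine_rep \<sigma> = A'' (quotient_action E \<Gamma> \<sigma>)"
proof (rule hom_factor[OF quotient_action_hom_Q _ affine_rep_hom affine_rep_eq])
  show "quotient_action E \<Gamma> ` N = carrier Q" by simp
  show "monoid (periodic_Aut E \<Gamma>)" by (rule group.is_monoid[OF group_N])
qed

text \<open>The inverse appears because p \<circ> \<sigma> is the position map of the placement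
  moved by the inverse of \<sigma>. A symmetry constrains positions only; the matching condition on
  \<pi> follows by computing the position of \<sigma> (\<gamma> x) in two ways.\<close>

lemma framework_symmetry_iff:
  assumes s: "\<sigma> \<in> N" and P: "P \<in> placements \<Gamma>"
  shows "framework_symmetry P \<sigma>
    \<longleftrightarrow> parameter_point \<phi> v i0 P = parameter_point \<phi> v i0 (placement_action \<Gamma> (inv_into UNIV \<sigma>) P)"
proof -
  let ?\<tau> = "inv_into UNIV \<sigma>"
  have t: "?\<tau> \<in> N" using s by (rule inv_N)
  obtain p \<pi> where Pe: "P = (p, \<pi>)" by (cases P)
  have p: "p (\<gamma> x) = p x + \<pi> \<gamma>" if "\<gamma> \<in> \<Gamma>" for \<gamma> x
    using P that by (simp add: Pe placements_def)
  have act: "placement_action \<Gamma> ?\<tau> P = (p \<circ> \<sigma>, \<lambda>\<gamma>\<in>\<Gamma>. \<pi> (\<sigma> \<circ> \<gamma> \<circ> ?\<tau>))"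
    by (simp add: Pe placement_action_eq[OF t] inv_inv_N[OF s])
  have "framework_symmetry P \<sigma> \<longleftrightarrow> isometry_equivalent \<Gamma> P (placement_action \<Gamma> ?\<tau> P)"
  proof
    assume "framework_symmetry P \<sigma>"
    then obtain U c where U: "orthogonal_transformation U" and eq: "(\<lambda>x. U x + c) \<circ> p = p \<circ> \<sigma>"
      by (auto simp: framework_symmetry_def Pe)
    have eqx: "p (\<sigma> x) = U (p x) + c" for x using fun_cong[OF eq, of x] by simp
    have lin: "linear U" using U by (rule orthogonal_transformation_linear)
    have "\<pi> (\<sigma> \<circ> \<gamma> \<circ> ?\<tau>) = U (\<pi> \<gamma>)" if g: "\<gamma> \<in> \<Gamma>" for \<gamma>
    proof -
      obtain x :: 'v where True by simp
      have "p (\<sigma> (\<gamma> x)) = p ((\<sigma> \<circ> \<gamma> \<circ> ?\<tau>) (\<sigma> x))"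
        using bij_N[OF s] by (simp add: bij_is_inj)
      also have "\<dots> = p (\<sigma> x) + \<pi> (\<sigma> \<circ> \<gamma> \<circ> ?\<tau>)" by (rule p[OF conj_\<Gamma>[OF s g]])
      finally show ?thesis by (simp add: eqx p[OF g] linear_add[OF lin])
    qed
    then have "placement_action \<Gamma> ?\<tau> P = ((\<lambda>x. U x + c) \<circ> fst P, restrict (U \<circ> snd P) \<Gamma>)"
      unfolding act unfolding Pe fst_conv snd_conv eq
      by (intro arg_cong2[of _ _ _ _ Pair] refl restrict_ext) simp
    then show "isometry_equivalent \<Gamma> P (placement_action \<Gamma> ?\<tau> P)"
      using U unfolding isometry_equivalent_def by blast
  next
    assume "isometry_equivalent \<Gamma> P (placement_action \<Gamma> ?\<tau> P)"
    then obtain U c where "orthogonal_transformation U" "p \<circ> \<sigma> = (\<lambda>x. U x + c) \<circ> p"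
      unfolding isometry_equivalent_def act by (auto simp: Pe)
    then show "framework_symmetry P \<sigma>"
      unfolding framework_symmetry_def by (intro exI[of _ U] exI[of _ c]) (simp add: Pe)
  qed
  then show ?thesis using parameter_point_eq_iff[OF P placement_action_closed[OF t P]] by simp
qed

lemma symmetric_placement_iff:
  assumes \<Sigma>: "subgroup \<Sigma> (periodic_Aut E \<Gamma>)" and P: "P \<in> placements \<Gamma>"
  shows "P \<in> symmetric_placements \<Gamma> \<Sigma> \<longleftrightarrow> parameter_point \<phi> v i0 P \<in> fixed_locus i0 affine_rep \<Sigma>"
proof -
  let ?pp = "parameter_point \<phi> v i0"
  have N: "\<sigma> \<in> N" if "\<sigma> \<in> \<Sigma>" for \<sigma> using subgroup.mem_carrier[OF \<Sigma> that] .
  have inv: "inv_into UNIV \<sigma> \<in> \<Sigma>" if "\<sigma> \<in> \<Sigma>" for \<sigma>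
    using subgroup.m_inv_closed[OF \<Sigma> that] inv_mult_N[OF N[OF that]] by simp
  have "P \<in> symmetric_placements \<Gamma> \<Sigma> \<longleftrightarrow> (\<forall>\<sigma>\<in>\<Sigma>. framework_symmetry P \<sigma>)"
    using P by (simp add: symmetric_placements_def)
  also have "\<dots> \<longleftrightarrow> (\<forall>\<sigma>\<in>\<Sigma>. affine_rep (inv_into UNIV \<sigma>) (?pp P) = ?pp P)"
    using framework_symmetry_iff[OF N P] affine_rep_parameter_point[OF inv_N[OF N] P] by (metis (lifting))
  \<comment> \<open>The inverses disappear because \<Sigma> is closed under inversion.\<close>
  also have "\<dots> \<longleftrightarrow> (\<forall>\<sigma>\<in>\<Sigma>. affine_rep \<sigma> (?pp P) = ?pp P)"
    using inv inv_inv_N[OF N] by metis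
  finally show ?thesis
    using parameter_point_in_domain[OF P] by (simp add: fixed_locus_def)
qed

lemma image_symmetric_placements:
  assumes \<Sigma>: "subgroup \<Sigma> (periodic_Aut E \<Gamma>)"
  shows "parameter_point \<phi> v i0 ` symmetric_placements \<Gamma> \<Sigma> = fixed_locus i0 affine_rep \<Sigma>"
proof (intro equalityI subsetI)
  fix x assume "x \<in> parameter_point \<phi> v i0 ` symmetric_placements \<Gamma> \<Sigma>"
  then obtain P where P: "P \<in> symmetric_placements \<Gamma> \<Sigma>" "x = parameter_point \<phi> v i0 P" by blast
  moreover have "P \<in> placements \<Gamma>" using P(1) by (simp add: symmetric_placements_def)
  ultimately show "x \<in> fixed_locus i0 affine_rep \<Sigma>" using symmetric_placement_iff[OF \<Sigma>] by blast
next
  fix x assume x: "x \<in> fixed_locus i0 affine_rep \<Sigma>"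
  then have "x \<in> D" by (simp add: fixed_locus_def)
  then obtain P where "P \<in> placements \<Gamma>" "parameter_point \<phi> v i0 P = x" by (rule exists_placement)
  then show "x \<in> parameter_point \<phi> v i0 ` symmetric_placements \<Gamma> \<Sigma>"
    using symmetric_placement_iff[OF \<Sigma>] x by blast
qed

text \<open>The barycenter of an orbit of the finite group \<open>affine_rep ` N\<close> is a fixed point, and it lies in
  the parameter domain because that is convex.\<close>

lemma fixed_locus_nonempty: "fixed_locus i0 affine_rep N \<noteq> {}"
proof -
  obtain A'' where A'': "\<And>\<sigma>. \<sigma> \<in> N \<Longrightarrow> affine_rep \<sigma> = A'' (quotient_action E \<Gamma> \<sigma>)"
    using affine_rep_factors_Q by blast
  \<comment> \<open>The sum runs over the distinct maps, not over the infinite group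
    \<open>N\<close>; finiteness comes from the factorization through \<open>Q\<close>.\<close>
  define H where "H = affine_rep ` N"
  have "H = A'' ` quotient_action E \<Gamma> ` N"
    unfolding H_def image_image by (rule image_cong) (simp_all add: A'')
  then have fin: "finite H" using finite_Q by simp
  have ne: "H \<noteq> {}" using id_N by (auto simp: H_def)
  define x0 :: "('d, 'n) params" where "x0 = (0, mat 1)"
  have x0: "x0 \<in> D" by (simp add: x0_def parameter_domain_def positive_definite_mat_1)
  define x where "x = (1 / real (card H)) *\<^sub>R (\<Sum>h\<in>H. h x0)"
  have x: "x \<in> D"
    unfolding x_def using fin ne affine_rep_domain[OF _ x0]
    by (intro parameter_domain_scaleR parameter_domain_sum) (auto simp: H_def card_gt_0_iff)
  have "affine_rep \<sigma> x = x" if s: "\<sigma> \<in> N" for \<sigma>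
  proof -
    have "affine_rep \<sigma> x = linear_part \<sigma> x + translation_part \<sigma>"
      using x parameter_domain_subset by (auto simp: affine_rep_def)
    also have "\<dots> = (1 / real (card H)) *\<^sub>R (\<Sum>h\<in>H. linear_part \<sigma> (h x0) + translation_part \<sigma>)"
      unfolding x_def by (rule affine_average[OF linear_part[OF s] fin ne])
    also have "(\<Sum>h\<in>H. linear_part \<sigma> (h x0) + translation_part \<sigma>) = (\<Sum>h\<in>H. compose W (affine_rep \<sigma>) h x0)"
    proof (rule sum.cong)
      fix h assume "h \<in> H"
      then have "h x0 \<in> W" "x0 \<in> W"
        using affine_rep_domain[OF _ x0] x0 parameter_domain_subset unfolding H_def by blast+
      then show "linear_part \<sigma> (h x0) + translation_part \<sigma> = compose W (affine_rep \<sigma>) h x0"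
        by (simp add: compose_eq affine_rep_def[of \<sigma>])
    qed simp
    \<comment> \<open>Composition with \<open>affine_rep \<sigma>\<close> permutes \<open>H\<close>,
      with the inverse of \<sigma> undoing it.\<close>
    also have "\<dots> = (\<Sum>h\<in>H. h x0)"
    proof (rule sum.reindex_bij_witness[where i = "compose W (affine_rep (inv_into UNIV \<sigma>))" and j = "compose W (affine_rep \<sigma>)"])
      have comp: "compose W (affine_rep \<alpha>) (affine_rep \<beta>) = affine_rep (\<alpha> \<circ> \<beta>)" if "\<alpha> \<in> N" "\<beta> \<in> N" for \<alpha> \<beta>
        using that by (auto simp: compose_def affine_rep_comp affine_rep_def[of "\<alpha> \<circ> \<beta>"] fun_eq_iff
            dest: affine_rep_comp[of \<alpha> \<beta>])
      fix h assume "h \<in> H"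
      then obtain \<tau> where \<tau>: "\<tau> \<in> N" "h = affine_rep \<tau>" by (auto simp: H_def)
      note [simp] = \<tau> comp s inv_N comp_N
      show "compose W (affine_rep (inv_into UNIV \<sigma>)) (compose W (affine_rep \<sigma>) h) = h"
        "compose W (affine_rep \<sigma>) (compose W (affine_rep (inv_into UNIV \<sigma>)) h) = h"
        by (simp_all add: o_assoc comp_inv_N inv_comp_N)
      show "compose W (affine_rep \<sigma>) h \<in> H" "compose W (affine_rep (inv_into UNIV \<sigma>)) h \<in> H"
        by (simp_all add: H_def)
    qed simp
    finally show ?thesis by (simp add: x_def)
  qed
  with x have "x \<in> fixed_locus i0 affine_rep N" by (simp add: fixed_locus_def)
  then show ?thesis by blast
qed

end

theorem theorem4:
  fixes E :: "'v set set"
    and \<Gamma> :: "('v \<Rightarrow> 'v) set"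
    and \<phi> :: "('d::finite \<Rightarrow>\<^sub>0 int) \<Rightarrow> ('v \<Rightarrow> 'v)"
    and v :: "'n::finite \<Rightarrow> 'v"
    and i0 :: 'n
  assumes "periodic_graph CARD('d) E \<Gamma>"
    and "\<phi> \<in> iso (free_Abelian_group (UNIV :: 'd set)) (subgroup_of_Aut E \<Gamma>)"
    and "bij_betw (\<lambda>i. vertex_orbit E \<Gamma> (v i)) UNIV (vertex_orbits E \<Gamma>)"
  shows "group_action (periodic_Aut E \<Gamma>)
           (placements \<Gamma> :: ('v, 'd) placement set)
           (\<lambda>\<sigma>. restrict (placement_action \<Gamma> \<sigma>) (placements \<Gamma>)) \<and>
         dim (parameter_space i0 :: ('d, 'n) params set)
           = CARD('d) * CARD('n) + (CARD('d) choose 2) \<and>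
         (\<exists>A \<in> hom (periodic_Aut E \<Gamma>) (Aff (parameter_space i0)).
            (\<forall>\<sigma> \<in> carrier (periodic_Aut E \<Gamma>).
               \<forall>P \<in> (placements \<Gamma> :: ('v, 'd) placement set).
                 A \<sigma> (parameter_point \<phi> v i0 P)
                   = parameter_point \<phi> v i0 (placement_action \<Gamma> \<sigma> P)) \<and>
            (\<exists>A' \<in> hom (periodic_Aut E \<Gamma> Mod \<Gamma>) (Aff (parameter_space i0)).
               \<forall>\<sigma> \<in> carrier (periodic_Aut E \<Gamma>). A \<sigma> = A' (\<Gamma> #>\<^bsub>periodic_Aut E \<Gamma>\<^esub> \<sigma>)) \<and>
            (let Q = (multigraph_Aut (quotient_multigraph E \<Gamma>))
                       \<lparr>carrier := quotient_action E \<Gamma> ` carrier (periodic_Aut E \<Gamma>)\<rparr>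
             in subgroup (carrier Q) (multigraph_Aut (quotient_multigraph E \<Gamma>)) \<and>
                (\<exists>\<iota> \<in> iso (periodic_Aut E \<Gamma> Mod \<Gamma>) Q.
                   \<forall>\<sigma> \<in> carrier (periodic_Aut E \<Gamma>).
                     \<iota> (\<Gamma> #>\<^bsub>periodic_Aut E \<Gamma>\<^esub> \<sigma>) = quotient_action E \<Gamma> \<sigma>) \<and>
                (\<exists>A'' \<in> hom Q (Aff (parameter_space i0)).
                   \<forall>\<sigma> \<in> carrier (periodic_Aut E \<Gamma>). A \<sigma> = A'' (quotient_action E \<Gamma> \<sigma>))) \<and>
            (\<forall>\<Sigma>. subgroup \<Sigma> (periodic_Aut E \<Gamma>) \<and> \<Gamma> \<subseteq> \<Sigma> \<longrightarrow>
               (\<forall>P \<in> (placements \<Gamma> :: ('v, 'd) placement set).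
                  P \<in> symmetric_placements \<Gamma> \<Sigma>
                    \<longleftrightarrow> parameter_point \<phi> v i0 P \<in> fixed_locus i0 A \<Sigma>) \<and>
               parameter_point \<phi> v i0 ` symmetric_placements \<Gamma> \<Sigma> = fixed_locus i0 A \<Sigma> \<and>
               (\<forall>P \<in> symmetric_placements \<Gamma> \<Sigma>. \<forall>P' \<in> symmetric_placements \<Gamma> \<Sigma>.
                  parameter_point \<phi> v i0 P = parameter_point \<phi> v i0 P'
                    \<longleftrightarrow> isometry_equivalent \<Gamma> P P')) \<and>
            fixed_locus i0 A (carrier (periodic_Aut E \<Gamma>)) \<noteq> {})"
proof -
  interpret periodic_params E \<Gamma> \<phi> v i0
    using assms
    by (intro periodic_params.intro vertex_group.intro periodic_params_axioms.intro)
      (auto simp: periodic_graph_def)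
  show ?thesis
    unfolding Let_def
  proof (intro conjI bexI[of _ affine_rep] affine_rep_hom group_action_placements dim_parameter_space
      affine_rep_factors_Mod iso_Q affine_rep_factors_Q fixed_locus_nonempty allI ballI impI)
    fix \<sigma> P assume "\<sigma> \<in> N" "P \<in> (placements \<Gamma> :: ('v, 'd) placement set)"
    then show "affine_rep \<sigma> (parameter_point \<phi> v i0 P) = parameter_point \<phi> v i0 (placement_action \<Gamma> \<sigma> P)"
      by (rule affine_rep_parameter_point)
  next
    show "subgroup (carrier Q) M" using subgroup_Q by simp
  next
    fix \<Sigma> P assume "subgroup \<Sigma> (periodic_Aut E \<Gamma>) \<and> \<Gamma> \<subseteq> \<Sigma>"
      and "P \<in> (placements \<Gamma> :: ('v, 'd) placement set)"
    then show "P \<in> symmetric_placements \<Gamma> \<Sigma> \<longleftrightarrow> parameter_point \<phi> v i0 P \<in> fixed_locus i0 affine_rep \<Sigma>"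
      using symmetric_placement_iff by blast
  next
    fix \<Sigma> assume "subgroup \<Sigma> (periodic_Aut E \<Gamma>) \<and> \<Gamma> \<subseteq> \<Sigma>"
    then show "parameter_point \<phi> v i0 ` symmetric_placements \<Gamma> \<Sigma> = fixed_locus i0 affine_rep \<Sigma>"
      using image_symmetric_placements by blast
  next
    fix \<Sigma> and P P' :: "('v, 'd) placement"
    assume "P \<in> symmetric_placements \<Gamma> \<Sigma>" "P' \<in> symmetric_placements \<Gamma> \<Sigma>"
    then show "parameter_point \<phi> v i0 P = parameter_point \<phi> v i0 P' \<longleftrightarrow> isometry_equivalent \<Gamma> P P'"
      by (intro parameter_point_eq_iff) (simp_all add: symmetric_placements_def)
  qed
qed

end
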